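(* For a positive integer $r$, let $g(r)$ denote the minimum number of edges in an $r$-uniform intersecting hypergraph $\mathcal H$ with cover number $\tau(\mathcal H)=r$. The following bounds hold. (i) For every positive integer $r$, $g(r)\ge 3r-4$. (ii) For every real $\varepsilon>0$, there is $r_0$ such that, for every integer $r\ge r_0$, $$g(r)\ge \left(\frac{41-\sqrt{19}}{12}-\varepsilon\right)r.$$
   Context: A hypergraph $\mathcal H$ consists of a finite vertex set and a finite collection $E(\mathcal H)$ of edges, each a subset of the vertex set; hypergraphs here are simple (no repeated edges; allowing repeated edges does not change the value of $g(r)$). There is no restriction on the number of vertices. $\mathcal H$ is $r$-uniform if every edge has exactly $r$ vertices, and intersecting if every two of its edges have a common vertex. A cover (transversal) of $\mathcal H$ is a set of vertices meeting every edge; the cover number $\tau(\mathcal H)$ is the minimum size of a cover. *)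

theory Defs
  imports Complex_Main
begin

definition hypergraph :: "'a set \<Rightarrow> 'a set set \<Rightarrow> bool" where
  "hypergraph V E \<longleftrightarrow> finite V \<and> E \<subseteq> Pow V"

definition uniform :: "nat \<Rightarrow> 'a set set \<Rightarrow> bool" where
  "uniform r E \<longleftrightarrow> (\<forall>e\<in>E. card e = r)"

definition intersecting :: "'a set set \<Rightarrow> bool" where
  "intersecting E \<longleftrightarrow> pairwise (\<lambda>e f. e \<inter> f \<noteq> {}) E"

definition cover :: "'a set \<Rightarrow> 'a set set \<Rightarrow> 'a set \<Rightarrow> bool" where
  "cover V E T \<longleftrightarrow> T \<subseteq> V \<and> (\<forall>e\<in>E. T \<inter> e \<noteq> {})"

text \<open>A cover exists exactly when no edge is empty; in particular the minimum below is attained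
  for every \<open>r\<close>-uniform hypergraph with \<open>r \<ge> 1\<close>.\<close>

definition cover_number :: "'a set \<Rightarrow> 'a set set \<Rightarrow> nat" where
  "cover_number V E = (LEAST k. \<exists>T. cover V E T \<and> card T = k)"

definition admissible :: "nat \<Rightarrow> 'a set \<Rightarrow> 'a set set \<Rightarrow> bool" where
  "admissible r V E \<longleftrightarrow>
     hypergraph V E \<and> uniform r E \<and> intersecting E \<and> cover_number V E = r"

text \<open>Every finite hypergraph is isomorphic to one whose vertices are natural numbers, so
  restricting to vertices in \<^typ>\<open>nat\<close> loses nothing; see \<open>min_edges_le\<close> and
  \<open>min_edges_attained\<close> below.\<close>

definition min_edges :: "nat \<Rightarrow> nat" where
  "min_edges r = (LEAST m. \<exists>(V :: nat set) E. admissible r V E \<and> card E = m)"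

lemma cover_image_iff:
  assumes "inj_on h V" "E \<subseteq> Pow V" "T \<subseteq> V"
  shows "cover (h ` V) ((`) h ` E) (h ` T) \<longleftrightarrow> cover V E T"
proof -
  have "h ` T \<inter> h ` e = h ` (T \<inter> e)" if "e \<in> E" for e
    using that assms inj_on_image_Int[OF assms(1), of T e] by auto
  then show ?thesis
    using assms(3) by (auto simp: cover_def)
qed

lemma cover_number_image:
  assumes "inj_on h V" "E \<subseteq> Pow V"
  shows "cover_number (h ` V) ((`) h ` E) = cover_number V E"
proof -
  have "(\<exists>T. cover (h ` V) ((`) h ` E) T \<and> card T = k) \<longleftrightarrow> (\<exists>T. cover V E T \<and> card T = k)"
    (is "?L \<longleftrightarrow> ?R") for k
  proof
    assume ?L
    then obtain T where T: "cover (h ` V) ((`) h ` E) T" "card T = k" by blast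
    then have "T \<subseteq> h ` V" by (simp add: cover_def)
    then obtain S where S: "S \<subseteq> V" "T = h ` S" by (meson subset_imageE)
    have "cover V E S" using T(1) S cover_image_iff[OF assms S(1)] by simp
    moreover have "card S = k"
      using T(2) S card_image[OF inj_on_subset[OF assms(1) S(1)]] by simp
    ultimately show ?R by blast
  next
    assume ?R
    then obtain S where S: "cover V E S" "card S = k" by blast
    then have SV: "S \<subseteq> V" by (simp add: cover_def)
    have "cover (h ` V) ((`) h ` E) (h ` S)" using S(1) cover_image_iff[OF assms SV] by simp
    moreover have "card (h ` S) = k"
      using S(2) card_image[OF inj_on_subset[OF assms(1) SV]] by simp
    ultimately show ?L by blast
  qed
  then show ?thesis by (simp add: cover_number_def)
qed

lemma min_edges_le:
  fixes V :: "'a set"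
  assumes "admissible r V E"
  shows "min_edges r \<le> card E"
proof -
  have fin: "finite V" and EV: "E \<subseteq> Pow V" and un: "uniform r E" and it: "intersecting E"
    and cn: "cover_number V E = r"
    using assms by (auto simp: admissible_def hypergraph_def)
  obtain h :: "'a \<Rightarrow> nat" where h: "inj_on h V"
    using finite_imp_inj_to_nat_seg[OF fin] by blast
  have "hypergraph (h ` V) ((`) h ` E)" using fin EV by (auto simp: hypergraph_def)
  moreover have "uniform r ((`) h ` E)"
    unfolding uniform_def
  proof
    fix f assume "f \<in> (`) h ` E"
    then obtain e where e: "e \<in> E" "f = h ` e" by blast
    then have "inj_on h e" using h EV inj_on_subset by (metis PowD subsetD)
    then show "card f = r" using e un by (simp add: card_image uniform_def)
  qed
  moreover have "intersecting ((`) h ` E)"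
    using it unfolding intersecting_def pairwise_def by blast
  moreover have "cover_number (h ` V) ((`) h ` E) = r"
    using cover_number_image[OF h EV] cn by simp
  ultimately have "admissible r (h ` V) ((`) h ` E)" by (simp add: admissible_def)
  moreover have "card ((`) h ` E) = card E"
    by (rule card_image) (rule inj_on_subset[OF inj_on_image_Pow[OF h] EV])
  ultimately show ?thesis
    unfolding min_edges_def by (intro Least_le) blast
qed

lemma admissible_exists:
  assumes "r \<ge> 1"
  shows "\<exists>(V :: nat set) E. admissible r V E"
proof -
  define V where "V = {..<2 * r - 1}"
  define E where "E = {e. e \<subseteq> V \<and> card e = r}"
  have fin: "finite V" and cV: "card V = 2 * r - 1" by (auto simp: V_def)
  have "intersecting E"
    unfolding intersecting_def
  proof (rule pairwiseI)
    fix e f assume "e \<in> E" "f \<in> E"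
    then have ef: "e \<subseteq> V" "f \<subseteq> V" "card e = r" "card f = r" by (auto simp: E_def)
    show "e \<inter> f \<noteq> {}"
    proof
      assume "e \<inter> f = {}"
      then have "card (e \<union> f) = 2 * r"
        using ef fin by (simp add: card_Un_disjoint finite_subset)
      moreover have "card (e \<union> f) \<le> 2 * r - 1"
        using ef fin cV by (metis Un_least card_mono)
      ultimately show False using assms by simp
    qed
  qed
  moreover have "cover_number V E = r"
    unfolding cover_number_def
  proof (rule Least_equality)
    obtain T where T: "T \<subseteq> V" "card T = r"
      using obtain_subset_with_card_n[of r V] cV assms by (metis add_leD2 le_add_diff mult_2)
    have "T \<inter> e \<noteq> {}" if "e \<in> E" for e
    proof (cases "e = T")
      case True
      then show ?thesis using T assms by force
    next
      case False
      then show ?thesis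
        using \<open>intersecting E\<close> that T by (auto simp: intersecting_def pairwise_def E_def)
    qed
    then show "\<exists>T. cover V E T \<and> card T = r" using T by (auto simp: cover_def)
  next
    fix k assume "\<exists>T. cover V E T \<and> card T = k"
    then obtain T where T: "T \<subseteq> V" "\<forall>e\<in>E. T \<inter> e \<noteq> {}" "card T = k" by (auto simp: cover_def)
    show "r \<le> k"
    proof (rule ccontr)
      assume "\<not> r \<le> k"
      then have "r \<le> card (V - T)"
        using T fin cV card_Diff_subset[of T V] by (simp add: finite_subset)
      then obtain e where "e \<subseteq> V - T" "card e = r" by (meson obtain_subset_with_card_n)
      then show False using T(2) by (auto simp: E_def)
    qed
  qed
  moreover have "hypergraph V E" "uniform r E"
    using fin by (auto simp: hypergraph_def uniform_def E_def)
  ultimately show ?thesis unfolding admissible_def by blast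
qed

lemma min_edges_attained:
  assumes "r \<ge> 1"
  shows "\<exists>(V :: nat set) E. admissible r V E \<and> card E = min_edges r"
  unfolding min_edges_def
  by (rule LeastI_ex) (use admissible_exists[OF assms] in blast)

end

theory Submission
  imports Defs
begin

text \<open>The edges of an \<open>r\<close>-uniform intersecting hypergraph \<open>H\<close> are treated as points, and a set of edges
is called concurrent if its members share a vertex. Suppose that \<open>P\<close> is a packing, that is, a
family of pairwise disjoint concurrent sets of edges, and that \<open>R\<close> is the set of edges outside all
of them. One vertex for each member of \<open>P\<close> and one vertex for each pair in a pairing of \<open>R\<close> form a
cover, so cover number \<open>r\<close> forces \<open>r \<le> |P| + \<lceil>|R| / 2\<rceil>\<close> for every packing (\<open>packing_cover\<close>).
Lower bounds for the number \<open>m\<close> of edges therefore follow once \<open>H\<close> is shown to have packings that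
are far better than greedy ones.

Packings are chosen to be extremal, and extremality is exploited by exchanging one block of the
packing for several new ones. The basic count looks at one uncovered edge \<open>p\<close>: its \<open>r\<close> vertices must
reach all other edges. If no three uncovered edges are concurrent, then \<open>|R| - 1\<close> of these vertices
are used up by the other uncovered edges, one each, and the remaining ones reach few edges when
large concurrent sets have been removed beforehand. Hence \<open>p\<close> reaches many packed edges through
the vertices that it shares with other uncovered edges (\<open>reach_count\<close>). On the other hand,
if disjoint pairs of uncovered edges reach too many edges of a block \<open>B\<close>, then each of these pairs,
extended by the edges of \<open>B\<close> that it reaches, is a new block, and together these blocks beat \<open>B\<close>.
So, up to a bounded error, \<open>B\<close> is reached from an average \<open>p\<close> in at most \<open>|B| - 2\<close> of its edges.

For the bound \<open>3 r - 4\<close>, take a maximum packing \<open>G\<close> of quadruples and then a maximum packing \<open>T\<close> of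
triples in the rest. The two estimates, with their error terms
made explicit, give \<open>|T| + |R| \<le> r + 2\<close> (\<open>triple_packing_bound\<close>), and
with \<open>m = 4 |G| + 3 |T| + |R|\<close> the cover inequality does the rest.

For the asymptotic bound, remove a maximum packing of \<open>f\<close> concurrent quintuples; at most \<open>3 r + 1\<close>
edges remain, say \<open>\<kappa>\<close>. Two packings of the rest are compared. The first has the maximum number \<open>q'\<close> of
quadruples and then as many triples as possible, say \<open>t'\<close>, leaving \<open>\<rho>'\<close> edges. The second maximises
\<open>5 q + 2 t\<close> over packings with \<open>q\<close> quadruples and \<open>t\<close> triples, leaving \<open>\<rho>\<close> edges. Up to additive
constants, the exchange arguments give
\<open>t' + \<rho>' \<le> r\<close> (\<open>triple_packing_bound\<close>), \<open>4 \<kappa> \<le> 5 q' + 10 r\<close> (\<open>quad_packing_bound\<close>) and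
\<open>\<kappa> + 2 \<rho> \<le> 2 q + t + 3 r\<close> (\<open>mixed_packing_bound\<close>), while \<open>5 q' + 2 t' \<le> 5 q + 2 t\<close> by the choice of
the second packing. With the cover inequality for both packings, linear arithmetic yields
\<open>m \<ge> 55/18 r - C\<close> (\<open>edge_count_ge_55_18\<close>), and \<open>55/18\<close> exceeds \<open>(41 - \<surd>19)/12\<close> because
\<open>\<surd>19 > 13/3\<close>.\<close>

section \<open>Packings by concurrent sets and exchange\<close>

definition concurrent :: "'a set set \<Rightarrow> bool" where
  "concurrent A \<longleftrightarrow> (\<exists>v. \<forall>e\<in>A. v \<in> e)"

definition is_packing :: "'a set set \<Rightarrow> nat set \<Rightarrow> 'a set set set \<Rightarrow> bool" where
  "is_packing K D P \<longleftrightarrow>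
     (\<forall>A\<in>P. A \<subseteq> K \<and> card A \<in> D \<and> concurrent A) \<and> pairwise disjnt P"

definition weight :: "(nat \<Rightarrow> nat) \<Rightarrow> 'a set set set \<Rightarrow> nat" where
  "weight w P = (\<Sum>A\<in>P. w (card A))"

definition optimal :: "'a set set \<Rightarrow> nat set \<Rightarrow> (nat \<Rightarrow> nat) \<Rightarrow> 'a set set set \<Rightarrow> bool" where
  "optimal K D w P \<longleftrightarrow>
     is_packing K D P \<and> (\<forall>P'. is_packing K D P' \<longrightarrow> weight w P' \<le> weight w P)"

lemma concurrent_subset: "concurrent A \<Longrightarrow> B \<subseteq> A \<Longrightarrow> concurrent B"
  by (auto simp: concurrent_def)

lemma is_packing_empty: "is_packing K D {}"
  by (simp add: is_packing_def)

lemma finite_packing: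
  assumes "finite K" "is_packing K D P"
  shows "finite P" "finite (\<Union>P)"
proof -
  have "P \<subseteq> Pow K" "\<Union>P \<subseteq> K" using assms(2) by (auto simp: is_packing_def)
  then show "finite P" "finite (\<Union>P)" using assms(1) finite_subset by blast+
qed

lemma card_Union_packing:
  assumes "finite K" "is_packing K D P"
  shows "card (\<Union>P) = (\<Sum>A\<in>P. card A)"
  using assms finite_subset
  by (intro card_Union_disjoint) (auto simp: is_packing_def)

lemma card_packing_split:
  assumes "finite K" "is_packing K D P"
  shows "card K = (\<Sum>A\<in>P. card A) + card (K - \<Union>P)"
proof -
  have "\<Union>P \<subseteq> K" using assms(2) by (auto simp: is_packing_def)
  then show ?thesis
    using card_Union_packing[OF assms] finite_packing(2)[OF assms]
      card_Diff_subset[of "\<Union>P" K] card_mono[OF assms(1), of "\<Union>P"] by simp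
qed

lemma optimal_exists:
  assumes "finite K"
  shows "\<exists>P. optimal K D w P"
proof -
  let ?W = "weight w ` {P. is_packing K D P}"
  have "{P. is_packing K D P} \<subseteq> Pow (Pow K)" by (auto simp: is_packing_def)
  then have fin: "finite ?W" using assms by (meson finite_Pow_iff finite_imageI finite_subset)
  have ne: "?W \<noteq> {}" using is_packing_empty by blast
  obtain P where "is_packing K D P" "weight w P = Max ?W" using Max_in[OF fin ne] by auto
  then show ?thesis unfolding optimal_def using Max_ge[OF fin] by auto
qed

text \<open>Optimal packings are exploited through exchanges: a subfamily \<open>\<B>\<close> may be replaced by any packing of
the points that become free, and such a replacement cannot gain weight.\<close>

lemma optimal_exchange:
  assumes fin: "finite K" and zero: "0 \<notin> D" and opt: "optimal K D w P" and sub: "\<B> \<subseteq> P"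
    and new: "is_packing (\<Union>\<B> \<union> (K - \<Union>P)) D N"
  shows "weight w N \<le> weight w \<B>"
proof -
  have P: "is_packing K D P" using opt by (simp add: optimal_def)
  have finP: "finite P" using finite_packing[OF fin P] by blast
  have subK: "\<Union>\<B> \<union> (K - \<Union>P) \<subseteq> K" using P sub by (fastforce simp: is_packing_def)
  have finN: "finite N" using finite_packing[OF _ new] finite_subset[OF subK fin] by blast
  have disj: "A \<inter> A' = {}" if "A \<in> P - \<B>" "A' \<in> N" for A A'
  proof -
    have "A \<inter> B = {}" if "B \<in> \<B>" for B
      using P sub that \<open>A \<in> P - \<B>\<close> unfolding is_packing_def pairwise_def disjnt_def by (metis DiffD1 DiffD2 subsetD)
    moreover have "A' \<subseteq> \<Union>\<B> \<union> (K - \<Union>P)" using new that by (auto simp: is_packing_def)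
    ultimately show ?thesis using that by blast
  qed
  have "is_packing K D ((P - \<B>) \<union> N)"
    unfolding is_packing_def
  proof (intro conjI ballI pairwiseI)
    fix A assume "A \<in> (P - \<B>) \<union> N"
    then show "A \<subseteq> K" "card A \<in> D" "concurrent A"
      using P new subK unfolding is_packing_def by blast+
  next
    fix A A' assume "A \<in> (P - \<B>) \<union> N" "A' \<in> (P - \<B>) \<union> N" "A \<noteq> A'"
    moreover have "disjnt A A'" if "A \<in> P - \<B>" "A' \<in> P - \<B>"
      using P that \<open>A \<noteq> A'\<close> by (simp add: is_packing_def pairwise_def)
    moreover have "disjnt A A'" if "A \<in> N" "A' \<in> N"
      using new that \<open>A \<noteq> A'\<close> by (simp add: is_packing_def pairwise_def)
    moreover have "disjnt A A'" if "A \<in> P - \<B>" "A' \<in> N"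
      using disj[OF that] by (simp add: disjnt_def)
    moreover have "disjnt A A'" if "A' \<in> P - \<B>" "A \<in> N"
      using disj[OF that] by (simp add: disjnt_def Int_commute)
    ultimately show "disjnt A A'" by blast
  qed
  then have "weight w ((P - \<B>) \<union> N) \<le> weight w P" using opt by (simp add: optimal_def)
  moreover have "(P - \<B>) \<inter> N = {}"
  proof -
    have "A \<noteq> {}" if "A \<in> N" for A using new that zero by (auto simp: is_packing_def)
    then show ?thesis using disj by blast
  qed
  then have "weight w ((P - \<B>) \<union> N) = weight w (P - \<B>) + weight w N"
    using finP finN unfolding weight_def by (simp add: sum.union_disjoint)
  moreover have "weight w P = weight w (P - \<B>) + weight w \<B>"
    using finP sub unfolding weight_def by (metis add.commute sum.subset_diff)
  ultimately show ?thesis by simp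
qed

definition edges_at :: "'a \<Rightarrow> 'a set set \<Rightarrow> 'a set set" where
  "edges_at v K = {e\<in>K. v \<in> e}"

definition concurrency_le :: "nat \<Rightarrow> 'a set set \<Rightarrow> bool" where
  "concurrency_le d K \<longleftrightarrow> (\<forall>v. card (edges_at v K) \<le> d)"

lemma concurrency_leD:
  assumes "concurrency_le d K" "finite K" "A \<subseteq> K" "concurrent A"
  shows "card A \<le> d"
proof -
  obtain v where "A \<subseteq> edges_at v K" using assms(3,4) by (auto simp: concurrent_def edges_at_def)
  moreover have "finite (edges_at v K)" using assms(2) by (simp add: edges_at_def)
  ultimately show ?thesis
    using assms(1) by (meson card_mono concurrency_le_def order_trans)
qed

lemma concurrent_edges_at: "A \<subseteq> edges_at v K \<Longrightarrow> concurrent A"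
  by (auto simp: edges_at_def concurrent_def)

lemma optimal_concurrency_le:
  assumes fin: "finite K" and opt: "optimal K D w P" and "0 \<notin> D" "Suc d \<in> D" "w (Suc d) > 0"
  shows "concurrency_le d (K - \<Union>P)"
  unfolding concurrency_le_def
proof (intro allI, rule ccontr)
  fix v assume "\<not> card (edges_at v (K - \<Union>P)) \<le> d"
  then obtain A where A: "A \<subseteq> edges_at v (K - \<Union>P)" "card A = Suc d"
    by (meson not_less_eq_eq obtain_subset_with_card_n)
  have "is_packing (\<Union>{} \<union> (K - \<Union>P)) D {A}"
    using A assms(4) concurrent_edges_at[OF A(1)] by (auto simp: is_packing_def edges_at_def)
  from optimal_exchange[OF fin assms(3) opt _ this] show False using A(2) assms(5) by (simp add: weight_def)
qed

section \<open>What an uncovered edge reaches\<close>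

text \<open>A function \<open>Y\<close> on pairs is read as a labelling of the edges of the complete graph on \<open>R\<close> by sets of
labels; this is the set of labels seen from \<open>p\<close>. Below, \<open>R\<close> consists of the uncovered edges, the
labels are packed edges, and a pair is labelled by the packed edges through one chosen common vertex.\<close>

definition labels_at :: "'p set \<Rightarrow> ('p set \<Rightarrow> 'l set) \<Rightarrow> 'p \<Rightarrow> 'l set" where
  "labels_at R Y p = (\<Union>q\<in>R - {p}. Y {p, q})"

locale intersecting_family =
  fixes E :: "'a set set" and r :: nat
  assumes finite_E: "finite E" and r_pos: "r \<ge> 1"
    and card_edge: "e \<in> E \<Longrightarrow> card e = r"
    and meets: "e \<in> E \<Longrightarrow> f \<in> E \<Longrightarrow> e \<inter> f \<noteq> {}"
begin

lemma finite_edge: "e \<in> E \<Longrightarrow> finite e"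
  using card_edge r_pos by (metis card.infinite not_one_le_zero)

text \<open>Every edge meets a fixed edge \<open>p\<close> in one of its \<open>r\<close> vertices, and each vertex carries at most \<open>d\<close>
further edges.\<close>

lemma card_le_concurrency:
  assumes "K \<subseteq> E" "concurrency_le (Suc d) K"
  shows "card K \<le> d * r + 1"
proof (cases "K = {}")
  case False
  then obtain p where p: "p \<in> K" by blast
  have finK: "finite K" using assms finite_E finite_subset by blast
  have "K - {p} \<subseteq> (\<Union>v\<in>p. edges_at v K - {p})"
    using meets[of p] p assms(1) by (fastforce simp: edges_at_def)
  moreover have "finite (\<Union>v\<in>p. edges_at v K - {p})"
    using finK by (rule_tac finite_subset[of _ K]) (auto simp: edges_at_def)
  ultimately have "card (K - {p}) \<le> card (\<Union>v\<in>p. edges_at v K - {p})"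
    by (simp add: card_mono)
  also have "\<dots> \<le> (\<Sum>v\<in>p. card (edges_at v K - {p}))"
    using finite_edge p assms(1) by (intro card_UN_le) blast
  also have "\<dots> \<le> (\<Sum>v\<in>p. d)"
  proof (rule sum_mono)
    fix v assume "v \<in> p"
    then have "p \<in> edges_at v K" using p by (simp add: edges_at_def)
    then show "card (edges_at v K - {p}) \<le> d"
      using assms(2) unfolding concurrency_le_def
      by (metis card_Diff_singleton diff_Suc_1 diff_le_mono)
  qed
  also have "\<dots> = d * r" using card_edge p assms(1) by (simp add: subset_iff)
  finally show ?thesis using p finK by simp
qed simp

text \<open>One vertex is fixed for each pair, because the exchanges need the labels of a pair to be concurrent
with the pair and with each other.\<close>

definition meet :: "'a set set \<Rightarrow> 'a" where
  "meet e = (SOME v. \<forall>x\<in>e. v \<in> x)"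

lemma meet_in:
  assumes "p \<in> E" "q \<in> E"
  shows "meet {p, q} \<in> p" "meet {p, q} \<in> q"
proof -
  have "\<exists>v. \<forall>x\<in>{p, q}. v \<in> x" using meets[OF assms] by auto
  then have "\<forall>x\<in>{p, q}. meet {p, q} \<in> x" unfolding meet_def by (rule someI_ex)
  then show "meet {p, q} \<in> p" "meet {p, q} \<in> q" by auto
qed

text \<open>The vertices chosen for the pairs \<open>{p, q}\<close> with \<open>q\<close> in \<open>R\<close> are distinct, since no three edges of \<open>R\<close> are
concurrent. This leaves \<open>r + 1 - |R|\<close> vertices of \<open>p\<close>, each of which lies on at most \<open>d\<close> edges outside \<open>R\<close>;
everything else outside \<open>R\<close> has to be seen as a label.\<close>

lemma reach_count:
  assumes KE: "K \<subseteq> E" and RK: "R \<subseteq> K" and R2: "concurrency_le 2 R"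
    and Kd: "concurrency_le (Suc d) K" and p: "p \<in> R"
  shows "card (K - R) + d * card R
    \<le> card (labels_at R (\<lambda>e. edges_at (meet e) (K - R)) p) + d * (r + 1)"
proof -
  define L where "L = labels_at R (\<lambda>e. edges_at (meet e) (K - R)) p"
  define chosen where "chosen = (\<lambda>q. meet {p, q}) ` (R - {p})"
  have finK: "finite K" using KE finite_E finite_subset by blast
  have finR: "finite R" using RK finK finite_subset by blast
  have pE: "p \<in> E" using p RK KE by blast
  have inj: "inj_on (\<lambda>q. meet {p, q}) (R - {p})"
  proof (rule inj_onI, rule ccontr)
    fix q q' assume q: "q \<in> R - {p}" "q' \<in> R - {p}" "meet {p, q} = meet {p, q'}" "q \<noteq> q'"
    then have "q \<in> E" "q' \<in> E" using RK KE by auto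
    then have "meet {p, q} \<in> p" "meet {p, q} \<in> q" "meet {p, q} \<in> q'"
      using meet_in[OF pE] q(3) by (metis, metis, metis)
    then have "concurrent {p, q, q'}" unfolding concurrent_def by blast
    then have "card {p, q, q'} \<le> 2"
      using concurrency_leD[OF R2 finR, of "{p, q, q'}"] p q by blast
    moreover have "p \<noteq> q" "p \<noteq> q'" using q by blast+
    then have "card {p, q, q'} = 3" using q(4) by simp
    ultimately show False by simp
  qed
  have ch_sub: "chosen \<subseteq> p" using meet_in[OF pE] RK KE by (auto simp: chosen_def)
  have ch_card: "card chosen = card R - 1" using card_image[OF inj] p finR by (simp add: chosen_def)
  have finp: "finite p" using finite_edge[OF pE] .
  have fin_ch: "finite chosen" using ch_sub finp finite_subset by blast
  have le: "card R - 1 \<le> r"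
    using card_mono[OF finp ch_sub] ch_card card_edge[OF pE] by simp
  have "K - R \<subseteq> L \<union> (\<Union>v\<in>p - chosen. edges_at v (K - R))"
  proof
    fix c assume c: "c \<in> K - R"
    then obtain v where v: "v \<in> c" "v \<in> p" using meets[of p c] pE KE by blast
    show "c \<in> L \<union> (\<Union>v\<in>p - chosen. edges_at v (K - R))"
    proof (cases "v \<in> chosen")
      case True
      then show ?thesis using c v by (auto simp: L_def labels_at_def chosen_def edges_at_def)
    next
      case False
      then show ?thesis using c v by (auto simp: edges_at_def)
    qed
  qed
  moreover have "L \<subseteq> K" by (auto simp: L_def labels_at_def edges_at_def)
  moreover have "(\<Union>v\<in>p - chosen. edges_at v (K - R)) \<subseteq> K" by (auto simp: edges_at_def)
  ultimately have "card (K - R) \<le> card (L \<union> (\<Union>v\<in>p - chosen. edges_at v (K - R)))"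
    using finK by (meson card_mono finite_UnI finite_subset)
  also have "\<dots> \<le> card L + card (\<Union>v\<in>p - chosen. edges_at v (K - R))" by (rule card_Un_le)
  also have "card (\<Union>v\<in>p - chosen. edges_at v (K - R)) \<le> (\<Sum>v\<in>p - chosen. card (edges_at v (K - R)))"
    using finp by (intro card_UN_le) simp
  also have "\<dots> \<le> (\<Sum>v\<in>p - chosen. d)"
  proof (rule sum_mono)
    fix v assume "v \<in> p - chosen"
    then have "insert p (edges_at v (K - R)) \<subseteq> edges_at v K" using p RK by (auto simp: edges_at_def)
    moreover have "p \<notin> edges_at v (K - R)" using p by (simp add: edges_at_def)
    moreover have "finite (edges_at v K)" using finK by (simp add: edges_at_def)
    ultimately have "Suc (card (edges_at v (K - R))) \<le> card (edges_at v K)"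
      by (metis card_insert_disjoint card_mono finite_insert finite_subset)
    then show "card (edges_at v (K - R)) \<le> d"
      using Kd unfolding concurrency_le_def by (meson Suc_le_mono order_trans)
  qed
  also have "\<dots> = d * (r - (card R - 1))"
    using card_Diff_subset[OF fin_ch ch_sub] ch_card card_edge[OF pE] by simp
  finally have "card (K - R) \<le> card L + d * (r - (card R - 1))" by simp
  moreover have "r - (card R - 1) + card R = r + 1"
    using le p finR card_gt_0_iff[of R] by auto
  then have "d * (r - (card R - 1)) + d * card R = d * (r + 1)" by (metis distrib_left)
  ultimately show ?thesis by (simp add: L_def)
qed

end

lemma labels_at_cong:
  assumes "p \<in> R" "\<And>e. \<lbrakk>e \<subseteq> R; card e = 2\<rbrakk> \<Longrightarrow> Y e = Y' e"
  shows "labels_at R Y p = labels_at R Y' p"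
proof -
  have "Y {p, q} = Y' {p, q}" if "q \<in> R - {p}" for q
    using that assms(1) by (intro assms(2)) (auto simp: card_2_iff)
  then show ?thesis by (simp add: labels_at_def)
qed

lemma labels_at_Int: "labels_at R (\<lambda>e. Y e \<inter> B) p = labels_at R Y p \<inter> B"
  by (auto simp: labels_at_def)

lemma sum_labels_le:
  assumes "finite P" "finite (\<Union>P)" "\<And>e. Y e \<subseteq> \<Union>P"
  shows "(\<Sum>p\<in>R. card (labels_at R Y p))
    \<le> (\<Sum>B\<in>P. \<Sum>p\<in>R. card (labels_at R (\<lambda>e. Y e \<inter> B) p))"
proof -
  have "card (labels_at R Y p) \<le> (\<Sum>B\<in>P. card (labels_at R Y p \<inter> B))" for p
  proof -
    have "labels_at R Y p = (\<Union>B\<in>P. labels_at R Y p \<inter> B)"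
      using assms(3) by (fastforce simp: labels_at_def)
    then show ?thesis using card_UN_le[OF assms(1)] by metis
  qed
  then have "(\<Sum>p\<in>R. card (labels_at R Y p)) \<le> (\<Sum>p\<in>R. \<Sum>B\<in>P. card (labels_at R Y p \<inter> B))"
    by (rule sum_mono)
  also have "\<dots> = (\<Sum>B\<in>P. \<Sum>p\<in>R. card (labels_at R (\<lambda>e. Y e \<inter> B) p))"
    by (subst sum.swap) (simp add: labels_at_Int)
  finally show ?thesis .
qed

section \<open>Labelled complete graphs in which matchings see few labels\<close>

definition is_matching :: "'p set \<Rightarrow> 'p set set \<Rightarrow> bool" where
  "is_matching R M \<longleftrightarrow> (\<forall>e\<in>M. e \<subseteq> R \<and> card e = 2) \<and> pairwise disjnt M"

text \<open>A vertex may see labels through edges that all pass through one other vertex, so a bound on the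
labels of matchings does not obviously bound the labels of vertices. It does, up to boundedly many
exceptions. The proof is by induction on \<open>k\<close>. If some edge \<open>e\<close> with a label \<open>c\<close> is removed together with \<open>c\<close>,
then matchings of the rest see at most \<open>k - 1\<close> labels, so all but boundedly many of the rich vertices, those
with more than \<open>k\<close> labels, see some label only through an end of \<open>e\<close>. Disjoint edges give different such labels, hence there are at most
\<open>n\<close> disjoint labelled edges, and all labelled edges meet a bounded set \<open>Z\<close>. Among many rich
vertices outside \<open>Z\<close>, many have the same labels towards \<open>Z\<close>; matching these with different
elements of \<open>Z\<close> produces a matching with too many labels.\<close>

lemma few_vertices_see_many_labels:
  fixes n k :: nat
  shows "\<exists>C. \<forall>(R :: 'p set) (Y :: 'p set \<Rightarrow> 'l set) B.
    finite R \<longrightarrow> finite B \<longrightarrow> card B \<le> n \<longrightarrow> (\<forall>e. Y e \<subseteq> B) \<longrightarrow>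
    (\<forall>M. is_matching R M \<longrightarrow> card (\<Union>(Y ` M)) \<le> k) \<longrightarrow>
    card {p\<in>R. k < card (labels_at R Y p)} \<le> C"
proof (induction k)
  case 0
  show ?case
  proof (intro exI[of _ 0] allI impI)
    fix R :: "'p set" and Y :: "'p set \<Rightarrow> 'l set" and B
    assume fin: "finite R" "finite B" and Y: "\<forall>e. Y e \<subseteq> B"
      and M: "\<forall>M. is_matching R M \<longrightarrow> card (\<Union>(Y ` M)) \<le> 0"
    have "Y {p, q} = {}" if "p \<in> R" "q \<in> R - {p}" for p q
    proof -
      have "is_matching R {{p, q}}" using that by (auto simp: is_matching_def)
      then have "card (Y {p, q}) = 0" using M by fastforce
      moreover have "finite (Y {p, q})" using Y fin finite_subset by metis
      ultimately show ?thesis by simp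
    qed
    then have "labels_at R Y p = {}" if "p \<in> R" for p using that by (simp add: labels_at_def)
    then have "{p\<in>R. 0 < card (labels_at R Y p)} = {}" by auto
    then show "card {p\<in>R. 0 < card (labels_at R Y p)} \<le> 0" by (metis card.empty order.refl)
  qed
next
  case (Suc k)
  then obtain C0 where C0: "\<And>(R :: 'p set) (Y :: 'p set \<Rightarrow> 'l set) B.
    \<lbrakk>finite R; finite B; card B \<le> n; \<forall>e. Y e \<subseteq> B;
     \<forall>M. is_matching R M \<longrightarrow> card (\<Union>(Y ` M)) \<le> k\<rbrakk> \<Longrightarrow>
    card {p\<in>R. k < card (labels_at R Y p)} \<le> C0" by blast
  define C where "C = (n + 1) * (C0 + 2) + 2 * n + (k + 2) * 2 ^ (2 * n * n)"
  show ?case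
  proof (intro exI[of _ C] allI impI, rule ccontr)
    fix R :: "'p set" and Y :: "'p set \<Rightarrow> 'l set" and B
    assume fin: "finite R" "finite B" and nB: "card B \<le> n" and Y: "\<forall>e. Y e \<subseteq> B"
      and M: "\<forall>M. is_matching R M \<longrightarrow> card (\<Union>(Y ` M)) \<le> Suc k"
      and big: "\<not> card {p\<in>R. Suc k < card (labels_at R Y p)} \<le> C"
    define Q where "Q = {p\<in>R. Suc k < card (labels_at R Y p)}"
    \<comment> \<open>the labels that \<open>p\<close> sees through the edge \<open>e\<close> alone\<close>
    define only where "only = (\<lambda>e p. {l\<in>labels_at R Y p. \<forall>q\<in>R - {p}. l \<in> Y {p, q} \<longrightarrow> q \<in> e})"
    have finQ: "finite Q" using fin by (simp add: Q_def)
    have bigQ: "C < card Q" using big by (simp add: Q_def)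
    have lab_sub: "labels_at R Y p \<subseteq> B" for p using Y by (auto simp: labels_at_def)
    have finY: "finite (\<Union>(Y ` M'))" for M' using Y fin(2) by (metis UN_least finite_subset)
    have finMat: "finite M'" if "is_matching R M'" for M'
      using that fin(1) by (auto simp: is_matching_def intro: finite_subset[of M' "Pow R"])
    have exceptional: "card {p\<in>Q - e. only e p = {}} \<le> C0"
      if e: "e \<subseteq> R" "card e = 2" "Y e \<noteq> {}" for e
    proof -
      obtain c where c: "c \<in> Y e" using e by blast
      define Y' where "Y' = (\<lambda>e. Y e - {c})"
      have "card {p\<in>R - e. k < card (labels_at (R - e) Y' p)} \<le> C0"
      proof (rule C0)
        show "\<forall>M. is_matching (R - e) M \<longrightarrow> card (\<Union>(Y' ` M)) \<le> k"
        proof (intro allI impI)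
          fix M' assume M': "is_matching (R - e) M'"
          then have "is_matching R (insert e M')"
            using e unfolding is_matching_def pairwise_insert disjnt_def by blast
          then have "card (\<Union>(Y ` insert e M')) \<le> Suc k" using M by blast
          \<comment> \<open>the label \<open>c\<close> of \<open>e\<close> comes on top of the labels of \<open>M'\<close>\<close>
          moreover have "insert c (\<Union>(Y' ` M')) \<subseteq> \<Union>(Y ` insert e M')"
            using c by (auto simp: Y'_def)
          then have "card (insert c (\<Union>(Y' ` M'))) \<le> card (\<Union>(Y ` insert e M'))"
            using finY card_mono by blast
          moreover have "finite (\<Union>(Y' ` M'))"
            by (rule finite_subset[OF _ finY[of M']]) (auto simp: Y'_def)
          then have "card (insert c (\<Union>(Y' ` M'))) = Suc (card (\<Union>(Y' ` M')))"
            by (rule card_insert_disjoint) (simp add: Y'_def)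
          ultimately show "card (\<Union>(Y' ` M')) \<le> k" by simp
        qed
      qed (use fin nB Y in \<open>auto simp: Y'_def\<close>)
      moreover have "{p\<in>Q - e. only e p = {}} \<subseteq> {p\<in>R - e. k < card (labels_at (R - e) Y' p)}"
      proof clarify
        fix p assume p: "p \<in> Q" "p \<notin> e" "only e p = {}"
        have "labels_at R Y p - {c} \<subseteq> labels_at (R - e) Y' p"
        proof
          fix l assume l: "l \<in> labels_at R Y p - {c}"
          then have "l \<notin> only e p" using p by simp
          then obtain q where "q \<in> R - {p}" "l \<in> Y {p, q}" "q \<notin> e" using l by (auto simp: only_def)
          then show "l \<in> labels_at (R - e) Y' p" using l by (auto simp: labels_at_def Y'_def)
        qed
        moreover have "labels_at (R - e) Y' p \<subseteq> B" using Y by (auto simp: labels_at_def Y'_def)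
        ultimately have "card (labels_at R Y p - {c}) \<le> card (labels_at (R - e) Y' p)"
          using fin(2) by (meson card_mono finite_subset)
        moreover have "Suc k < card (labels_at R Y p)" using p by (simp add: Q_def)
        moreover have "card (labels_at R Y p) \<le> Suc (card (labels_at R Y p - {c}))"
          using diff_card_le_card_Diff[of "{c}" "labels_at R Y p"] by simp
        ultimately show "p \<in> R - e \<and> k < card (labels_at (R - e) Y' p)"
          using p by (simp add: Q_def)
      qed
      then have "card {p\<in>Q - e. only e p = {}} \<le> card {p\<in>R - e. k < card (labels_at (R - e) Y' p)}"
        using fin(1) by (intro card_mono) auto
      ultimately show ?thesis by linarith
    qed
    have matching_small: "card M' \<le> n" if M': "is_matching R M'" "\<forall>e\<in>M'. Y e \<noteq> {}" for M'
    proof (rule ccontr)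
      assume "\<not> card M' \<le> n"
      then obtain M1 where M1: "M1 \<subseteq> M'" "card M1 = n + 1" "finite M1"
        by (metis Suc_eq_plus1 not_less_eq_eq obtain_subset_with_card_n)
      have M1e: "e \<subseteq> R" "card e = 2" "Y e \<noteq> {}" if "e \<in> M1" for e
        using that M1 M' by (auto simp: is_matching_def)
      define bad where "bad = (\<Union>e\<in>M1. e \<union> {p\<in>Q - e. only e p = {}})"
      have "card bad \<le> (\<Sum>e\<in>M1. card (e \<union> {p\<in>Q - e. only e p = {}}))"
        unfolding bad_def using M1 by (intro card_UN_le)
      also have "\<dots> \<le> (\<Sum>e\<in>M1. 2 + C0)"
      proof (rule sum_mono)
        fix e assume "e \<in> M1"
        then show "card (e \<union> {p\<in>Q - e. only e p = {}}) \<le> 2 + C0"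
          using card_Un_le[of e "{p\<in>Q - e. only e p = {}}"] exceptional[of e] M1e[of e] by simp
      qed
      also have "\<dots> = (n + 1) * (C0 + 2)" using M1 by simp
      also have "\<dots> < card Q" using bigQ by (simp add: C_def)
      finally have "card bad < card Q" .
      moreover have "finite bad" 
        using M1(3) M1e(1) finite_subset[OF _ fin(1)] finQ by (auto simp: bad_def)
      ultimately obtain p where p: "p \<in> Q" "p \<notin> bad" by (meson card_mono leD subsetI)
      have "\<exists>l. l \<in> only e p" if "e \<in> M1" for e using p that by (auto simp: bad_def)
      then obtain g where g: "\<And>e. e \<in> M1 \<Longrightarrow> g e \<in> only e p" by metis
      have "inj_on g M1"
      proof (rule inj_onI, rule ccontr)
        fix e f assume ef: "e \<in> M1" "f \<in> M1" "g e = g f" "e \<noteq> f"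
        then have "g e \<in> labels_at R Y p" using g by (auto simp: only_def)
        then obtain q where "q \<in> R - {p}" "g e \<in> Y {p, q}" by (auto simp: labels_at_def)
        then have "q \<in> e \<inter> f" using g[OF ef(1)] g[OF ef(2)] ef(3) by (auto simp: only_def)
        moreover have "disjnt e f"
          using ef M1(1) M'(1) unfolding is_matching_def pairwise_def by (meson subsetD)
        ultimately show False by (auto simp: disjnt_def)
      qed
      moreover have "g ` M1 \<subseteq> B" using g lab_sub by (fastforce simp: only_def)
      ultimately have "card M1 \<le> card B" using fin(2) by (metis card_inj_on_le)
      then show False using M1 nB by simp
    qed
    define lm where "lm = (\<lambda>M'. is_matching R M' \<and> (\<forall>e\<in>M'. Y e \<noteq> {}))"
    have "lm {}" by (simp add: lm_def is_matching_def)
    moreover have "\<forall>M'. lm M' \<longrightarrow> card M' < Suc n"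
      using matching_small by (simp add: lm_def less_Suc_eq_le)
    ultimately obtain M0 where M0: "lm M0" and M0max: "\<And>M'. lm M' \<Longrightarrow> card M' \<le> card M0"
      using ex_has_greatest_nat[of lm "{}" card "Suc n"] by blast
    define Z where "Z = \<Union>M0"
    have finM0: "finite M0" using M0 finMat by (auto simp: lm_def)
    have ZR: "Z \<subseteq> R" using M0 by (auto simp: lm_def is_matching_def Z_def)
    have finZ: "finite Z" using ZR fin(1) finite_subset by blast
    have "card Z \<le> (\<Sum>e\<in>M0. card e)" unfolding Z_def using card_Union_le_sum_card by blast
    also have "\<dots> = 2 * card M0" using M0 by (simp add: lm_def is_matching_def)
    also have "\<dots> \<le> 2 * n" using matching_small M0 by (simp add: lm_def)
    finally have cardZ: "card Z \<le> 2 * n" .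
    have through_Z: "q \<in> Z" if "p \<in> R - Z" "q \<in> R - {p}" "Y {p, q} \<noteq> {}" for p q
    proof (rule ccontr)
      assume q: "q \<notin> Z"
      then have "{p, q} \<notin> M0" using that by (auto simp: Z_def)
      moreover have "lm (insert {p, q} M0)"
        using M0 that q unfolding lm_def is_matching_def pairwise_insert disjnt_def Z_def by auto
      ultimately show False using M0max[of "insert {p, q} M0"] finM0 by simp
    qed
    \<comment> \<open>the labels of \<open>p\<close> towards \<open>Z\<close>; there are boundedly many patterns, so one of them is frequent\<close>
    define pat where "pat = (\<lambda>p. {(z, l). z \<in> Z \<and> l \<in> Y {p, z}})"
    have "pat ` (Q - Z) \<subseteq> Pow (Z \<times> B)" using Y by (auto simp: pat_def)
    then have "card (pat ` (Q - Z)) \<le> card (Pow (Z \<times> B))" using finZ fin(2) by (intro card_mono) auto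
    also have "\<dots> = 2 ^ (card Z * card B)"
      using finZ fin(2) by (simp add: card_Pow card_cartesian_product)
    also have "\<dots> \<le> 2 ^ (2 * n * n)" using cardZ nB by (intro power_increasing mult_mono) auto
    finally have patterns: "card (pat ` (Q - Z)) \<le> 2 ^ (2 * n * n)" .
    have "\<exists>\<phi>. k + 2 < card {p\<in>Q - Z. pat p = \<phi>}"
    proof (rule ccontr)
      assume "\<nexists>\<phi>. k + 2 < card {p\<in>Q - Z. pat p = \<phi>}"
      then have small: "card {p\<in>Q - Z. pat p = \<phi>} \<le> k + 2" for \<phi> by (meson not_le)
      have "Q - Z = (\<Union>\<phi>\<in>pat ` (Q - Z). {p\<in>Q - Z. pat p = \<phi>})" by auto
      then have "card (Q - Z) \<le> (\<Sum>\<phi>\<in>pat ` (Q - Z). card {p\<in>Q - Z. pat p = \<phi>})"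
        using card_UN_le[of "pat ` (Q - Z)" "\<lambda>\<phi>. {p\<in>Q - Z. pat p = \<phi>}"] finQ by simp
      also have "\<dots> \<le> (\<Sum>\<phi>\<in>pat ` (Q - Z). k + 2)" using small by (intro sum_mono)
      also have "\<dots> \<le> (k + 2) * 2 ^ (2 * n * n)" using mult_le_mono2[OF patterns, of "k + 2"]
        by (simp add: mult.commute)
      finally have "card (Q - Z) \<le> (k + 2) * 2 ^ (2 * n * n)" .
      moreover have "card Q \<le> card (Q - Z) + card Z"
        using diff_card_le_card_Diff[OF finZ, of Q] by simp
      ultimately show False using bigQ cardZ by (simp add: C_def)
    qed
    then obtain \<phi> where \<phi>: "k + 2 < card {p\<in>Q - Z. pat p = \<phi>}" by blast
    define G where "G = {p\<in>Q - Z. pat p = \<phi>}"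
    obtain p0 where p0: "p0 \<in> G" using \<phi> by (metis G_def card.empty ex_in_conv less_nat_zero_code)
    have "k + 2 \<le> card (labels_at R Y p0)" using p0 by (auto simp: G_def Q_def)
    then obtain L where L: "L \<subseteq> labels_at R Y p0" "card L = k + 2" "finite L"
      by (meson obtain_subset_with_card_n)
    have "\<exists>z\<in>Z. l \<in> Y {p0, z}" if "l \<in> L" for l
    proof -
      obtain q where "q \<in> R - {p0}" "l \<in> Y {p0, q}" 
        using subsetD[OF L(1) \<open>l \<in> L\<close>] by (auto simp: labels_at_def)
      then show ?thesis using through_Z[of p0 q] p0 by (auto simp: G_def Q_def)
    qed
    then obtain zf where zf: "\<And>l. l \<in> L \<Longrightarrow> zf l \<in> Z" "\<And>l. l \<in> L \<Longrightarrow> l \<in> Y {p0, zf l}" by metis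
    have "card (zf ` L) \<le> card G" using card_image_le[OF L(3), of zf] L(2) \<phi> by (simp add: G_def)
    moreover have "finite G" using finQ by (simp add: G_def)
    ultimately obtain h where h: "h ` (zf ` L) \<subseteq> G" "inj_on h (zf ` L)"
      using L(3) by (meson card_le_inj finite_imageI)
    define M' where "M' = (\<lambda>z. {z, h z}) ` (zf ` L)"
    have hz: "z \<in> Z" "h z \<in> G" if "z \<in> zf ` L" for z using that h zf by auto
    have "is_matching R M'"
      unfolding is_matching_def
    proof (intro conjI ballI pairwiseI)
      fix e assume "e \<in> M'"
      then obtain z where z: "z \<in> zf ` L" "e = {z, h z}" by (auto simp: M'_def)
      have "z \<noteq> h z" "z \<in> R" "h z \<in> R" using hz[OF z(1)] ZR by (auto simp: G_def Q_def)
      then show "e \<subseteq> R" "card e = 2" using z by auto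
    next
      fix e f assume ef: "e \<in> M'" "f \<in> M'" "e \<noteq> f"
      obtain z where z1: "z \<in> zf ` L" "e = {z, h z}" using ef(1) unfolding M'_def by blast
      obtain z' where z2: "z' \<in> zf ` L" "f = {z', h z'}" using ef(2) unfolding M'_def by blast
      have z: "z \<in> zf ` L" "z' \<in> zf ` L" "e = {z, h z}" "f = {z', h z'}" "z \<noteq> z'"
        using z1 z2 ef(3) by blast+
      have "h z \<noteq> h z'" using h(2) z by (meson inj_onD)
      then show "disjnt e f" using hz[OF z(1)] hz[OF z(2)] z by (auto simp: G_def disjnt_def)
    qed
    then have "card (\<Union>(Y ` M')) \<le> Suc k" using M by blast
    moreover have "L \<subseteq> \<Union>(Y ` M')"
    proof
      fix l assume l: "l \<in> L"
      have "(zf l, l) \<in> pat p0" using zf[OF l] by (simp add: pat_def)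
      also have "pat p0 = pat (h (zf l))" using p0 hz(2)[of "zf l"] l by (simp add: G_def)
      finally have "l \<in> Y {h (zf l), zf l}" by (simp add: pat_def)
      then show "l \<in> \<Union>(Y ` M')" using l by (auto simp: M'_def insert_commute)
    qed
    then have "card L \<le> card (\<Union>(Y ` M'))" using finY card_mono by blast
    ultimately show False using L(2) by simp
  qed
qed

lemma sum_labels_le_of_few_exceptions:
  assumes "finite R" "finite B" "card {p\<in>R. k < card (labels_at R Y p)} \<le> C" "\<And>e. Y e \<subseteq> B"
  shows "(\<Sum>p\<in>R. card (labels_at R Y p)) \<le> k * card R + card B * C"
proof -
  let ?Q = "{p\<in>R. k < card (labels_at R Y p)}"
  have le: "card (labels_at R Y p) \<le> card B" for p
    using assms(2,4) by (intro card_mono) (auto simp: labels_at_def)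
  have "(\<Sum>p\<in>R. card (labels_at R Y p)) \<le> (\<Sum>p\<in>R. k + (if p \<in> ?Q then card B else 0))"
    using le by (intro sum_mono) (auto simp: trans_le_add2)
  also have "\<dots> = k * card R + card B * card ?Q"
    using assms(1) by (simp add: sum.distrib sum.If_cases Int_def mult.commute)
  finally show ?thesis using assms(3) by (meson add_left_mono mult_le_mono2 le_trans)
qed

lemma doubleton_eqI:
  assumes "card e = 2" "x \<in> e" "y \<in> e" "x \<noteq> y"
  shows "e = {x, y}"
proof -
  obtain a b where "e = {a, b}" using assms(1) by (meson card_2_iff)
  then show ?thesis using assms by auto
qed

text \<open>If two of the covers were disjoint, the edges would live on their four vertices. So the three covers
meet pairwise: either they form a triangle, which leaves three vertices only, or they share a vertex,
and an edge avoiding it would contain three different points.\<close>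

lemma common_vertex_of_three_covers:
  assumes e2: "\<And>e. e \<in> N \<Longrightarrow> card e = 2" and big: "card (\<Union>N) \<ge> 5"
    and c: "card c1 = 2" "card c2 = 2" "card c3 = 2" "c1 \<noteq> c2" "c1 \<noteq> c3" "c2 \<noteq> c3"
    and cov: "\<And>e. e \<in> N \<Longrightarrow> e \<inter> c1 \<noteq> {}" "\<And>e. e \<in> N \<Longrightarrow> e \<inter> c2 \<noteq> {}"
       "\<And>e. e \<in> N \<Longrightarrow> e \<inter> c3 \<noteq> {}"
  shows "\<exists>z. \<forall>e\<in>N. z \<in> e"
proof -
  have finc: "finite c1" "finite c2" "finite c3" using c by (auto intro: card_ge_0_finite)
  have meet2: "c \<inter> d \<noteq> {}"
    if cd: "card c = 2" "card d = 2" "\<And>e. e \<in> N \<Longrightarrow> e \<inter> c \<noteq> {}" "\<And>e. e \<in> N \<Longrightarrow> e \<inter> d \<noteq> {}"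
    for c d
  proof
    assume dis: "c \<inter> d = {}"
    have fin: "finite c" "finite d" using cd by (auto intro: card_ge_0_finite)
    have "e \<subseteq> c \<union> d" if e: "e \<in> N" for e
    proof -
      obtain x y where xy: "x \<in> e" "x \<in> c" "y \<in> e" "y \<in> d" using cd(3,4)[OF e] by blast
      then have "x \<noteq> y" using dis by blast
      then have "e = {x, y}" using doubleton_eqI[OF e2[OF e]] xy by blast
      then show ?thesis using xy by blast
    qed
    then have "\<Union>N \<subseteq> c \<union> d" by blast
    then have "card (\<Union>N) \<le> card (c \<union> d)" using fin by (simp add: card_mono)
    also have "\<dots> \<le> 4" using card_Un_le[of c d] cd by simp
    finally show False using big by simp
  qed
  obtain a b where c1: "c1 = {a, b}" "a \<noteq> b" using c(1) by (meson card_2_iff)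
  obtain z x where zx: "z \<in> c1" "c2 = {z, x}" "x \<noteq> z"
  proof -
    obtain z where "z \<in> c1 \<inter> c2" using meet2[OF c(1,2) cov(1,2)] by blast
    moreover obtain u w where "c2 = {u, w}" "u \<noteq> w" using c(2) by (meson card_2_iff)
    ultimately show ?thesis using that by (cases "z = u") auto
  qed
  obtain y where y: "c1 = {z, y}" "y \<noteq> z" using c1 zx(1) by (cases "z = a") auto
  have xy: "x \<noteq> y" using y zx c(4) by auto
  have "z \<in> c3"
  proof (rule ccontr)
    assume z3: "z \<notin> c3"
    have "x \<in> c3" "y \<in> c3" using meet2[OF c(2,3) cov(2,3)] meet2[OF c(1,3) cov(1,3)] zx y z3 by auto
    then have c3: "c3 = {x, y}" using doubleton_eqI[OF c(3)] xy by blast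
    have "e \<subseteq> {x, y, z}" if e: "e \<in> N" for e
    proof -
      obtain u w where uw: "e = {u, w}" using e2[OF e] by (meson card_2_iff)
      have "u \<in> {z, y} \<or> w \<in> {z, y}" using cov(1)[OF e] uw y(1) by blast
      moreover have "u \<in> {z, x} \<or> w \<in> {z, x}" using cov(2)[OF e] uw zx(2) by blast
      moreover have "u \<in> {x, y} \<or> w \<in> {x, y}" using cov(3)[OF e] uw c3 by blast
      ultimately show ?thesis using uw xy zx(3) y(2) by auto
    qed
    then have "\<Union>N \<subseteq> {x, y, z}" by blast
    then have "card (\<Union>N) \<le> card {x, y, z}" by (intro card_mono) auto
    also have "\<dots> \<le> 3" by (simp add: card_insert_if)
    finally show False using big by simp
  qed
  then obtain w where w: "c3 = {z, w}" "w \<noteq> z"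
  proof -
    obtain u v where "c3 = {u, v}" "u \<noteq> v" using c(3) by (meson card_2_iff)
    then show ?thesis using that \<open>z \<in> c3\<close> by (cases "z = u") auto
  qed
  have "z \<in> e" if e: "e \<in> N" for e
  proof (rule ccontr)
    assume "z \<notin> e"
    then have "x \<in> e" "y \<in> e" "w \<in> e"
      using cov(1)[OF e] cov(2)[OF e] cov(3)[OF e] y(1) zx(2) w(1) by blast+
    moreover have "w \<noteq> x" "w \<noteq> y" using c(5,6) y(1) zx(2) w(1) by blast+
    ultimately show False using doubleton_eqI[OF e2[OF e], of x y] xy by blast
  qed
  then show ?thesis by blast
qed

text \<open>For three labels and matchings that see one label, the error term can be made explicit, which the
bound \<open>3 r - 4\<close> needs. The pairs labelled \<open>b\<close> form a graph \<open>N b\<close> with vertex set \<open>V b\<close>; these three graphs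
are edge-disjoint, and edges of different graphs intersect. If each \<open>V b\<close> has at most four elements,
the sum is at most 12. Otherwise fix a label \<open>a\<close> with \<open>|V a| \<ge> 5\<close>. The edges of the other two graphs cover
\<open>N a\<close>: at most two of them contribute at most 4 in total, and if there are three, then all graphs are
stars with the same centre, and every other vertex sees one label only.\<close>

lemma sum_labels_of_three:
  assumes finR: "finite R" and B: "card B = 3" and Y: "\<And>e. Y e \<subseteq> B"
    and one: "\<And>e. card (Y e) \<le> 1"
    and disj: "\<And>e f. \<lbrakk>e \<subseteq> R; f \<subseteq> R; card e = 2; card f = 2; e \<inter> f = {}\<rbrakk> \<Longrightarrow> card (Y e \<union> Y f) \<le> 1"
  shows "(\<Sum>p\<in>R. card (labels_at R Y p)) \<le> max (card R + 4) 12"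
proof -
  have finB: "finite B" using B by (auto intro: card_ge_0_finite)
  define N where "N = (\<lambda>b. {e. e \<subseteq> R \<and> card e = 2 \<and> b \<in> Y e})"
  define V where "V = (\<lambda>b. {p\<in>R. b \<in> labels_at R Y p})"
  have finY: "finite (Y e)" for e using Y finB finite_subset by blast
  have finN: "finite (N b)" for b
    by (rule finite_subset[of _ "Pow R"]) (auto simp: N_def finR)
  have finV: "finite (V b)" for b using finR by (simp add: V_def)
  have V_le: "card (V b) \<le> card R" for b using finR by (auto simp: V_def intro: card_mono)
  have V_Union: "V b = \<Union>(N b)" for b
  proof
    show "V b \<subseteq> \<Union>(N b)"
    proof
      fix p assume "p \<in> V b"
      then obtain q where "p \<in> R" "q \<in> R - {p}" "b \<in> Y {p, q}" by (auto simp: V_def labels_at_def)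
      then have "{p, q} \<in> N b" by (auto simp: N_def)
      then show "p \<in> \<Union>(N b)" by blast
    qed
    show "\<Union>(N b) \<subseteq> V b"
    proof
      fix p assume "p \<in> \<Union>(N b)"
      then obtain e where e: "e \<subseteq> R" "card e = 2" "b \<in> Y e" "p \<in> e" by (auto simp: N_def)
      then obtain u w where "e = {u, w}" "u \<noteq> w" by (meson card_2_iff)
      then obtain q where q: "e = {p, q}" "q \<noteq> p" using e(4) by (cases "p = u") auto
      have "b \<in> labels_at R Y p" unfolding labels_at_def using e q by (intro UN_I[of q]) auto
      then show "p \<in> V b" using e by (auto simp: V_def)
    qed
  qed
  have edge_label: "a = b" if "a \<in> Y e" "b \<in> Y e" for a b e
    using one[of e] that finY by (metis card_le_Suc0_iff_eq One_nat_def)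
  have cross: "e \<inter> f \<noteq> {}" if "e \<in> N a" "f \<in> N b" "a \<noteq> b" for e f a b
  proof
    assume "e \<inter> f = {}"
    then have "card (Y e \<union> Y f) \<le> 1" using that disj by (auto simp: N_def)
    moreover have "{a, b} \<subseteq> Y e \<union> Y f" using that by (auto simp: N_def)
    then have "card {a, b} \<le> card (Y e \<union> Y f)" using finY by (intro card_mono) auto
    ultimately show False using that by simp
  qed
  have "(\<Sum>p\<in>R. card (labels_at R Y p)) = (\<Sum>p\<in>R. \<Sum>b\<in>B. if b \<in> labels_at R Y p then 1 else 0)"
  proof (rule sum.cong)
    fix p
    have "labels_at R Y p \<subseteq> B" using Y by (auto simp: labels_at_def)
    then have "B \<inter> {b. b \<in> labels_at R Y p} = labels_at R Y p" by blast
    then show "card (labels_at R Y p) = (\<Sum>b\<in>B. if b \<in> labels_at R Y p then 1 else 0)"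
      using finB by (simp add: sum.If_cases)
  qed simp
  also have "\<dots> = (\<Sum>b\<in>B. \<Sum>p\<in>R. if b \<in> labels_at R Y p then 1 else 0)" by (rule sum.swap)
  also have "\<dots> = (\<Sum>b\<in>B. card (V b))" using finR by (simp add: sum.If_cases V_def Int_def)
  finally have total: "(\<Sum>p\<in>R. card (labels_at R Y p)) = (\<Sum>b\<in>B. card (V b))" .
  show ?thesis
  proof (cases "\<forall>b\<in>B. card (V b) \<le> 4")
    case True
    then have "(\<Sum>b\<in>B. card (V b)) \<le> (\<Sum>b\<in>B. 4)" by (intro sum_mono) auto
    then show ?thesis using total B by simp
  next
    case False
    then obtain a where "a \<in> B" "\<not> card (V a) \<le> 4" by blast
    then have a: "a \<in> B" "card (V a) \<ge> 5" by simp_all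
    define N' where "N' = (\<Union>b\<in>B - {a}. N b)"
    have finN': "finite N'" using finB finN by (simp add: N'_def)
    have N'_edge: "e \<subseteq> R" "card e = 2" if "e \<in> N'" for e using that by (auto simp: N'_def N_def)
    have N'_cross: "e \<inter> f \<noteq> {}" if "e \<in> N a" "f \<in> N'" for e f
      using cross that by (force simp: N'_def)
    have split: "(\<Sum>b\<in>B. card (V b)) = card (V a) + (\<Sum>b\<in>B - {a}. card (V b))"
      using a(1) finB by (meson sum.remove)
    have N'_card: "card N' = (\<Sum>b\<in>B - {a}. card (N b))"
      unfolding N'_def using finB finN edge_label
      by (subst card_UN_disjoint) (auto simp: N_def)
    have twice: "card (V b) \<le> 2 * card (N b)" for b
    proof -
      have "card (\<Union>(N b)) \<le> (\<Sum>e\<in>N b. card e)" by (rule card_Union_le_sum_card)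
      also have "\<dots> = 2 * card (N b)" by (simp add: N_def)
      finally show ?thesis by (simp add: V_Union)
    qed
    show ?thesis
    proof (cases "card N' \<le> 2")
      case True
      have "(\<Sum>b\<in>B - {a}. card (V b)) \<le> (\<Sum>b\<in>B - {a}. 2 * card (N b))" using twice by (intro sum_mono)
      also have "\<dots> = 2 * card N'" by (simp add: N'_card sum_distrib_left)
      finally show ?thesis using total split V_le[of a] True by simp
    next
      case False
      then obtain T where T: "T \<subseteq> N'" "card T = 3"
        by (metis not_less_eq_eq numeral_3_eq_3 numeral_2_eq_2 obtain_subset_with_card_n)
      then obtain c1 c2 c3 where c: "T = {c1, c2, c3}" "c1 \<noteq> c2" "c1 \<noteq> c3" "c2 \<noteq> c3"
        by (auto simp: card_3_iff)
      have cN: "c1 \<in> N'" "c2 \<in> N'" "c3 \<in> N'" using c T by blast+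
      have Na2: "card e = 2" if "e \<in> N a" for e using that by (simp add: N_def)
      have Na5: "5 \<le> card (\<Union>(N a))" using a V_Union by simp
      have "\<exists>z. \<forall>e\<in>N a. z \<in> e"
        using common_vertex_of_three_covers[OF Na2 Na5 N'_edge(2)[OF cN(1)] N'_edge(2)[OF cN(2)]
            N'_edge(2)[OF cN(3)] c(2,3,4) N'_cross[OF _ cN(1)] N'_cross[OF _ cN(2)] N'_cross[OF _ cN(3)]] .
      then obtain z where z: "\<And>e. e \<in> N a \<Longrightarrow> z \<in> e" by blast
      have z_all: "z \<in> f" if f: "f \<in> N'" for f
      proof (rule ccontr)
        assume zf: "z \<notin> f"
        have "V a \<subseteq> insert z f"
        proof
          fix p assume "p \<in> V a"
          then obtain e where e: "e \<in> N a" "p \<in> e" using V_Union by blast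
          have e2: "card e = 2" using e(1) by (simp add: N_def)
          obtain q where q: "q \<in> e" "q \<in> f" using N'_cross[OF e(1) f] by blast
          then have "e = {z, q}"
            using doubleton_eqI[OF e2 z[OF e(1)] q(1)] zf by blast
          then show "p \<in> insert z f" using e q by blast
        qed
        moreover have f2: "card f = 2" "finite f" using N'_edge[OF f] finR finite_subset by auto
        ultimately have "card (V a) \<le> card (insert z f)" by (intro card_mono) auto
        also have "\<dots> \<le> 3" using f2 by (simp add: card_insert_if)
        finally show False using a(2) by simp
      qed
      have all: "z \<in> e" if "e \<in> N b" "b \<in> B" for e b
        using z z_all that by (cases "b = a") (auto simp: N'_def)
      have zR: "z \<in> R" using z_all T c N'_edge(1) by blast
      have other: "card (labels_at R Y p) \<le> 1" if p: "p \<in> R - {z}" for p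
      proof -
        have "labels_at R Y p \<subseteq> Y {p, z}"
        proof
          fix b assume "b \<in> labels_at R Y p"
          then obtain q where q: "q \<in> R - {p}" "b \<in> Y {p, q}" by (auto simp: labels_at_def)
          then have "{p, q} \<in> N b" using p by (auto simp: N_def)
          then have "z \<in> {p, q}" using all Y q by blast
          then show "b \<in> Y {p, z}" using q p by auto
        qed
        then show ?thesis using one[of "{p, z}"] finY card_mono order_trans by blast
      qed
      have "(\<Sum>p\<in>R. card (labels_at R Y p))
          = card (labels_at R Y z) + (\<Sum>p\<in>R - {z}. card (labels_at R Y p))"
        using zR finR by (meson sum.remove)
      also have "(\<Sum>p\<in>R - {z}. card (labels_at R Y p)) \<le> (\<Sum>p\<in>R - {z}. 1)"
        using other by (intro sum_mono)
      also have "\<dots> \<le> card R" using card_Diff1_le[of R z] by simp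
      finally have "(\<Sum>p\<in>R. card (labels_at R Y p)) \<le> card (labels_at R Y z) + card R" by simp
      moreover have "card (labels_at R Y z) \<le> card B"
        using Y finB by (intro card_mono) (auto simp: labels_at_def)
      ultimately show ?thesis using B by simp
    qed
  qed
qed

context intersecting_family begin

section \<open>Triples, and the bound 3r - 4\<close>

lemma concurrent_pair_with_labels:
  assumes KE: "K \<subseteq> E" and RK: "R \<subseteq> K" "e \<subseteq> R" "card e = 2"
  shows "concurrent (e \<union> edges_at (meet e) (K - R))"
proof -
  obtain p q where "e = {p, q}" using assms(4) by (meson card_2_iff)
  then show ?thesis
    using meet_in[of p q] assms unfolding concurrent_def edges_at_def by blast
qed

text \<open>Write \<open>t = |T|\<close> and \<open>\<rho>\<close> for the number of uncovered edges. If two disjoint pairs of uncovered edges were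
labelled by different edges of a triple, then two new triples would replace it; so
\<open>sum_labels_of_three\<close> applies to each triple. If the claim failed, then by \<open>reach_count\<close> every
uncovered edge would see at least \<open>t + 4\<close> labels, whence \<open>\<rho> (t + 4) \<le> t max (\<rho> + 4) 12\<close>. This is impossible,
because \<open>3 t + \<rho> \<le> 2 r + 1\<close> makes \<open>\<rho>\<close> exceed \<open>t\<close> by at least 5.\<close>

lemma triple_packing_bound:
  assumes KE: "K \<subseteq> E" and K3: "concurrency_le 3 K" and opt: "optimal K {3} (\<lambda>_. 1) T"
  shows "card T + card (K - \<Union>T) \<le> r + 2"
proof (rule ccontr)
  assume neg: "\<not> card T + card (K - \<Union>T) \<le> r + 2"
  define R where "R = K - \<Union>T"
  define Y where "Y = (\<lambda>e. edges_at (meet e) (K - R))"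
  have finK: "finite K" using KE finite_E finite_subset by blast
  have pack: "is_packing K {3} T" using opt by (simp add: optimal_def)
  have finT: "finite T" "finite (\<Union>T)" using finite_packing[OF finK pack] by auto
  have RK: "R \<subseteq> K" and finR: "finite R" using finK by (auto simp: R_def)
  have UT: "K - R = \<Union>T" using pack by (auto simp: R_def is_packing_def)
  have "(\<Sum>A\<in>T. card A) = (\<Sum>A\<in>T. 3)" using pack by (intro sum.cong) (auto simp: is_packing_def)
  then have cK: "card K = 3 * card T + card R"
    using card_packing_split[OF finK pack] by (simp add: R_def)
  have K3': "concurrency_le (Suc 2) K" using K3 by simp
  have K_le: "card K \<le> 2 * r + 1" using card_le_concurrency[OF KE K3'] .
  have R2: "concurrency_le 2 R"
    unfolding R_def using optimal_concurrency_le[OF finK opt, of 2] by simp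
  have "card (K - R) = 3 * card T" using cK RK finR finK by (simp add: card_Diff_subset)
  then have reach: "3 * card T + 2 * card R \<le> card (labels_at R Y p) + 2 * (r + 1)" if "p \<in> R" for p
    using reach_count[OF KE RK R2 K3' that] unfolding Y_def by linarith
  have per_block: "(\<Sum>p\<in>R. card (labels_at R (\<lambda>e. if e \<subseteq> R \<and> card e = 2 then Y e \<inter> B else {}) p))
      \<le> max (card R + 4) 12" if B: "B \<in> T" for B
  proof (rule sum_labels_of_three[OF finR])
    let ?Y = "\<lambda>e. if e \<subseteq> R \<and> card e = 2 then Y e \<inter> B else {}"
    show B3: "card B = 3" using B pack by (auto simp: is_packing_def)
    show "?Y e \<subseteq> B" for e by auto
    have BR: "B \<inter> R = {}" using B by (auto simp: R_def)
    have finB: "finite B" using B3 by (auto intro: card_ge_0_finite)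
    show le1: "card (?Y e) \<le> 1" for e
    proof (cases "e \<subseteq> R \<and> card e = 2")
      case True
      have sub: "e \<union> Y e \<inter> B \<subseteq> K" using True RK by (auto simp: Y_def edges_at_def)
      have "concurrent (e \<union> Y e \<inter> B)"
        by (rule concurrent_subset[OF concurrent_pair_with_labels[OF KE RK, of e]])
          (use True in \<open>auto simp: Y_def\<close>)
      then have "card (e \<union> Y e \<inter> B) \<le> 3" using concurrency_leD[OF K3 finK sub] by blast
      moreover have "card (e \<union> Y e \<inter> B) = card e + card (Y e \<inter> B)"
        using True BR finB finite_subset[OF _ finR, of e] by (intro card_Un_disjoint) auto
      ultimately show ?thesis using True by simp
    qed auto
    show "card (?Y e \<union> ?Y f) \<le> 1"
      if ef: "e \<subseteq> R" "f \<subseteq> R" "card e = 2" "card f = 2" "e \<inter> f = {}" for e f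
    proof (rule ccontr)
      assume "\<not> card (?Y e \<union> ?Y f) \<le> 1"
      then have u: "\<not> card ((Y e \<union> Y f) \<inter> B) \<le> 1" using ef by (simp add: Int_Un_distrib2)
      have "card (Y e \<inter> B) \<le> 1" "card (Y f \<inter> B) \<le> 1" using le1[of e] le1[of f] ef by simp_all
      then have single: "x = y" if "x \<in> Y g \<inter> B" "y \<in> Y g \<inter> B" "g \<in> {e, f}" for x y g
        using that finB card_le_Suc0_iff_eq[of "Y g \<inter> B"] by auto
      have "\<exists>x\<in>(Y e \<union> Y f) \<inter> B. \<exists>y\<in>(Y e \<union> Y f) \<inter> B. x \<noteq> y"
        using u finB card_le_Suc0_iff_eq[of "(Y e \<union> Y f) \<inter> B"] by auto
      then obtain a b where ab: "a \<in> Y e \<inter> B" "b \<in> Y f \<inter> B" "a \<noteq> b"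
        using single by blast
      have "is_packing (\<Union>{B} \<union> (K - \<Union>T)) {3} {insert a e, insert b f}"
      proof -
        have "concurrent (insert a e)" "concurrent (insert b f)"
          using concurrent_subset[OF concurrent_pair_with_labels[OF KE RK], of e "insert a e"]
            concurrent_subset[OF concurrent_pair_with_labels[OF KE RK], of f "insert b f"] ef ab
          by (auto simp: Y_def)
        moreover have "a \<notin> e" "b \<notin> f" "a \<notin> f" "b \<notin> e" using ab ef BR by auto
        moreover have "finite e" "finite f" using ef finR finite_subset by auto
        ultimately show ?thesis
          using ab ef by (auto simp: is_packing_def pairwise_def disjnt_def R_def)
      qed
      from optimal_exchange[OF finK _ opt _ this] B have "weight (\<lambda>_. 1) {insert a e, insert b f} \<le> weight (\<lambda>_. 1) {B}"
        by simp
      moreover have "a \<notin> insert b f" using ab ef(2) BR by auto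
      then have "insert a e \<noteq> insert b f" by (metis insertI1)
      ultimately show False by (simp add: weight_def)
    qed
  qed
  have "(\<Sum>p\<in>R. card (labels_at R Y p)) \<le> (\<Sum>B\<in>T. \<Sum>p\<in>R. card (labels_at R (\<lambda>e. Y e \<inter> B) p))"
    using sum_labels_le[OF finT, of Y R] UT by (auto simp: Y_def edges_at_def)
  also have "\<dots> = (\<Sum>B\<in>T. \<Sum>p\<in>R. card (labels_at R (\<lambda>e. if e \<subseteq> R \<and> card e = 2 then Y e \<inter> B else {}) p))"
    by (intro sum.cong refl arg_cong[where f = card] labels_at_cong) auto
  also have "\<dots> \<le> (\<Sum>B\<in>T. max (card R + 4) 12)" using per_block by (intro sum_mono)
  finally have upper: "(\<Sum>p\<in>R. card (labels_at R Y p)) \<le> card T * max (card R + 4) 12" by simp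
  define t where "t = card T"
  define \<rho> where "\<rho> = card R"
  have big: "t + \<rho> \<ge> r + 3" using neg by (simp add: t_def \<rho>_def R_def)
  have small: "3 * t + \<rho> \<le> 2 * r + 1" using K_le cK by (simp add: t_def \<rho>_def)
  have "t + 4 \<le> card (labels_at R Y p)" if "p \<in> R" for p
    using reach[OF that] big by (simp add: t_def \<rho>_def)
  then have "(\<Sum>p\<in>R. t + 4) \<le> (\<Sum>p\<in>R. card (labels_at R Y p))" by (intro sum_mono)
  then have main: "\<rho> * (t + 4) \<le> t * max (\<rho> + 4) 12" using upper by (simp add: t_def \<rho>_def)
  have gap: "t + 5 \<le> \<rho>" using big small by linarith
  show False
  proof (cases "\<rho> \<ge> 8")
    case True
    then have "max (\<rho> + 4) 12 = \<rho> + 4" by simp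
    then have "\<rho> * t + \<rho> * 4 \<le> \<rho> * t + t * 4"
      using main by (simp add: distrib_left mult.commute)
    then show False using gap by simp
  next
    case False
    then have "\<rho> \<in> {5, 6, 7}" using gap by auto
    then show False using main gap by auto
  qed
qed

end

lemma packing_extend:
  assumes P: "is_packing K D P" and P': "is_packing (K - \<Union>P) D' P'" and zero: "0 \<notin> D'"
  shows "is_packing K (D \<union> D') (P \<union> P')" "P \<inter> P' = {}"
proof -
  have dis: "A \<inter> A' = {}" if "A \<in> P" "A' \<in> P'" for A A'
    using that P' by (auto simp: is_packing_def)
  show "is_packing K (D \<union> D') (P \<union> P')"
    unfolding is_packing_def
  proof (intro conjI ballI pairwiseI)
    fix A assume "A \<in> P \<union> P'"
    then show "A \<subseteq> K" "card A \<in> D \<union> D'" "concurrent A"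
      using P P' unfolding is_packing_def by blast+
  next
    fix A A' assume AA: "A \<in> P \<union> P'" "A' \<in> P \<union> P'" "A \<noteq> A'"
    then consider "A \<in> P" "A' \<in> P" | "A \<in> P'" "A' \<in> P'" | "A \<in> P" "A' \<in> P'" | "A' \<in> P" "A \<in> P'"
      by blast
    then show "disjnt A A'"
    proof cases
      case 1 then show ?thesis using P AA(3) by (simp add: is_packing_def pairwise_def)
    next
      case 2 then show ?thesis using P' AA(3) by (simp add: is_packing_def pairwise_def)
    next
      case 3 then show ?thesis using dis by (simp add: disjnt_def)
    next
      case 4 then show ?thesis using dis by (simp add: disjnt_def Int_commute)
    qed
  qed
  have "A \<noteq> {}" if "A \<in> P'" for A using that P' zero by (auto simp: is_packing_def)
  then show "P \<inter> P' = {}" using dis by blast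
qed

lemma card_uniform_packing:
  assumes "finite K" "is_packing K {s} P"
  shows "card K = s * card P + card (K - \<Union>P)"
proof -
  have "(\<Sum>A\<in>P. card A) = (\<Sum>A\<in>P. s)" using assms(2) by (intro sum.cong) (auto simp: is_packing_def)
  then show ?thesis using card_packing_split[OF assms] by simp
qed

locale cover_critical_family = intersecting_family +
  assumes cover_ge: "\<lbrakk>finite T; \<And>e. e \<in> E \<Longrightarrow> T \<inter> e \<noteq> {}\<rbrakk> \<Longrightarrow> r \<le> card T"
begin

lemma pairing_cover:
  assumes "K \<subseteq> E"
  shows "\<exists>T. finite T \<and> card T \<le> (card K + 1) div 2 \<and> (\<forall>e\<in>K. T \<inter> e \<noteq> {})"
  using assms
proof (induction "card K" arbitrary: K rule: less_induct)
  case less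
  have finK: "finite K" using less.prems finite_E finite_subset by blast
  show ?case
  proof (cases "K = {}")
    case True
    then show ?thesis by (intro exI[of _ "{}"]) simp
  next
    case False
    then obtain p where p: "p \<in> K" by blast
    show ?thesis
    proof (cases "K = {p}")
      case True
      obtain v where "v \<in> p" using meets[of p p] p less.prems by blast
      then show ?thesis using True by (intro exI[of _ "{v}"]) auto
    next
      case False
      then obtain q where q: "q \<in> K" "q \<noteq> p" using p by blast
      define K' where "K' = K - {p, q}"
      have c: "card K = card K' + 2"
        using p q finK card_Diff_subset[of "{p, q}" K] card_mono[OF finK, of "{p, q}"]
        by (simp add: K'_def)
      obtain T where T: "finite T" "card T \<le> (card K' + 1) div 2" "\<forall>e\<in>K'. T \<inter> e \<noteq> {}"
        using less.hyps[of K'] c less.prems by (auto simp: K'_def)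
      have "card (insert (meet {p, q}) T) \<le> Suc (card T)" by (simp add: T(1) card_insert_if)
      also have "\<dots> \<le> (card K + 1) div 2" using T(2) c by simp
      finally have "card (insert (meet {p, q}) T) \<le> (card K + 1) div 2" .
      moreover have "insert (meet {p, q}) T \<inter> e \<noteq> {}" if "e \<in> K" for e
        using T(3) that meet_in[of p q] p q less.prems by (cases "e \<in> K'") (auto simp: K'_def)
      ultimately show ?thesis using T(1) by blast
    qed
  qed
qed

lemma packing_cover:
  assumes "is_packing E D P"
  shows "r \<le> card P + (card (E - \<Union>P) + 1) div 2"
proof -
  have "\<exists>v. \<forall>e\<in>A. v \<in> e" if "A \<in> P" for A
    using assms that by (auto simp: is_packing_def concurrent_def)
  then obtain g where g: "\<And>A e. \<lbrakk>A \<in> P; e \<in> A\<rbrakk> \<Longrightarrow> g A \<in> e" by metis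
  obtain T where T: "finite T" "card T \<le> (card (E - \<Union>P) + 1) div 2" "\<forall>e\<in>E - \<Union>P. T \<inter> e \<noteq> {}"
    using pairing_cover[of "E - \<Union>P"] by auto
  have finP: "finite P" using finite_packing[OF finite_E assms] by blast
  have "r \<le> card (g ` P \<union> T)"
  proof (rule cover_ge)
    show "(g ` P \<union> T) \<inter> e \<noteq> {}" if "e \<in> E" for e
      using g T(3) that by (cases "e \<in> \<Union>P") blast+
  qed (simp add: finP T)
  also have "\<dots> \<le> card P + card T"
    using card_Un_le[of "g ` P" T] card_image_le[OF finP, of g] by linarith
  finally show ?thesis using T(2) by linarith
qed

lemma edges_ge_3r_minus_4: "3 * r \<le> card E + 4"
proof -
  obtain G where G: "optimal E {4} (\<lambda>_. 1) G" using optimal_exists[OF finite_E] by blast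
  define K where "K = E - \<Union>G"
  have finK: "finite K" using finite_E by (simp add: K_def)
  obtain T where T: "optimal K {3} (\<lambda>_. 1) T" using optimal_exists[OF finK] by blast
  have packs: "is_packing E {4} G" "is_packing K {3} T" using G T by (auto simp: optimal_def)
  have "concurrency_le 3 K"
    unfolding K_def using optimal_concurrency_le[OF finite_E G, of 3] by simp
  then have bound: "card T + card (K - \<Union>T) \<le> r + 2"
    using triple_packing_bound[OF _ _ T] by (simp add: K_def)
  have ext: "is_packing E ({4} \<union> {3}) (G \<union> T)" "G \<inter> T = {}"
    using packing_extend[OF packs(1), of "{3}" T] packs(2) by (auto simp: K_def)
  have "card (G \<union> T) = card G + card T"
    using ext(2) finite_packing[OF finite_E packs(1)] finite_packing[OF finK packs(2)]
    by (simp add: card_Un_disjoint)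
  moreover have "E - \<Union>(G \<union> T) = K - \<Union>T" by (auto simp: K_def)
  ultimately have "r \<le> card G + card T + (card (K - \<Union>T) + 1) div 2"
    using packing_cover[OF ext(1)] by simp
  moreover have "card E = 4 * card G + card K" "card K = 3 * card T + card (K - \<Union>T)"
    using card_uniform_packing[OF finite_E packs(1)] card_uniform_packing[OF finK packs(2)]
    by (simp_all add: K_def)
  ultimately show ?thesis using bound by linarith
qed

end

section \<open>Packings with the maximum number of quadruples\<close>

lemma disjoint_member_of_large_matching:
  assumes "finite A" "pairwise disjnt M" "card A < card M"
  shows "\<exists>A'\<in>M. A \<inter> A' = {}"
proof (rule ccontr)
  assume "\<not> ?thesis"
  then have "\<forall>A'\<in>M. \<exists>x. x \<in> A \<inter> A'" by blast
  then obtain g where g: "\<And>A'. A' \<in> M \<Longrightarrow> g A' \<in> A \<inter> A'" by metis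
  have "inj_on g M"
  proof (rule inj_onI, rule ccontr)
    fix X Y assume XY: "X \<in> M" "Y \<in> M" "g X = g Y" "X \<noteq> Y"
    then have "disjnt X Y" using assms(2) by (simp add: pairwise_def)
    then show False using g[OF XY(1)] g[OF XY(2)] XY(3) by (auto simp: disjnt_def)
  qed
  moreover have "g ` M \<subseteq> A" using g by blast
  ultimately have "card M \<le> card A" using assms(1) by (metis card_inj_on_le)
  then show False using assms(3) by simp
qed

text \<open>Take a maximal matching \<open>M\<close>. Every other triple meets it, so it covers at most two points outside \<open>M\<close>.
For triples that hardly overlap, \<open>|\<Union>H|\<close> is close to \<open>3 |H|\<close>, and then \<open>3 |M|\<close> is close to \<open>|\<Union>H|\<close> as well;
overlaps are the price of the estimate.\<close>

lemma triple_system_matching: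
  assumes fin: "finite H" and H3: "\<And>A. A \<in> H \<Longrightarrow> card A = 3"
  shows "\<exists>M\<subseteq>H. pairwise disjnt M \<and> card (\<Union>H) \<le> card M + 2 * card H"
proof -
  define dm where "dm = (\<lambda>M. M \<subseteq> H \<and> pairwise disjnt M)"
  have "\<forall>M. dm M \<longrightarrow> card M < Suc (card H)"
    using card_mono[OF fin] by (auto simp: dm_def less_Suc_eq_le)
  moreover have "dm {}" by (simp add: dm_def)
  ultimately obtain M where M: "dm M" and max: "\<And>M'. dm M' \<Longrightarrow> card M' \<le> card M"
    using ex_has_greatest_nat[of dm "{}" card "Suc (card H)"] by blast
  have MH: "M \<subseteq> H" using M by (simp add: dm_def)
  have finM: "finite M" using MH fin finite_subset by blast
  have finA: "finite A" if "A \<in> H" for A using H3[OF that] by (auto intro: card_ge_0_finite)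
  have hits: "card (A - \<Union>M) \<le> 2" if A: "A \<in> H - M" for A
  proof -
    have "A \<inter> \<Union>M \<noteq> {}"
    proof
      assume "A \<inter> \<Union>M = {}"
      then have "dm (insert A M)"
        using M A unfolding dm_def pairwise_insert disjnt_def by blast
      then show False using max[of "insert A M"] A finM by simp
    qed
    then have "A - \<Union>M \<subset> A" by blast
    then have "card (A - \<Union>M) < card A" using finA A by (simp add: psubset_card_mono)
    then show ?thesis using H3[of A] A by simp
  qed
  have "\<Union>H \<subseteq> \<Union>M \<union> (\<Union>A\<in>H - M. A - \<Union>M)" by blast
  moreover have "finite (\<Union>M \<union> (\<Union>A\<in>H - M. A - \<Union>M))" using finA fin MH finM by auto
  ultimately have "card (\<Union>H) \<le> card (\<Union>M \<union> (\<Union>A\<in>H - M. A - \<Union>M))" by (rule_tac card_mono)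
  also have "\<dots> \<le> card (\<Union>M) + card (\<Union>A\<in>H - M. A - \<Union>M)" by (rule card_Un_le)
  also have "card (\<Union>M) \<le> (\<Sum>A\<in>M. card A)" by (rule card_Union_le_sum_card)
  also have "(\<Sum>A\<in>M. card A) = (\<Sum>A\<in>M. 3)" using H3 MH by (intro sum.cong) auto
  also have "card (\<Union>A\<in>H - M. A - \<Union>M) \<le> (\<Sum>A\<in>H - M. card (A - \<Union>M))"
    using fin by (intro card_UN_le) simp
  also have "\<dots> \<le> (\<Sum>A\<in>H - M. 2)" using hits by (intro sum_mono)
  finally have "card (\<Union>H) \<le> 3 * card M + 2 * card (H - M)" by simp
  moreover have "card H = card M + card (H - M)"
    using card_Diff_subset[OF finM MH] card_mono[OF fin MH] by simp
  ultimately show ?thesis using M unfolding dm_def by (intro exI[of _ M]) simp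
qed

context intersecting_family begin

text \<open>Let \<open>S\<close> be the uncovered part and \<open>U\<close> the covered part. For \<open>c\<close> in \<open>U\<close> let \<open>H c\<close> be the triples in \<open>S\<close> that
form a quadruple with \<open>c\<close>. If two edges \<open>a\<close> and \<open>b\<close> of one block had disjoint triples in \<open>H a\<close> and \<open>H b\<close>,
then two quadruples would replace the block. So within a block, if the matching chosen in one
\<open>H b\<close> has at least four triples, then those in the other \<open>H c\<close> are empty, and the matchings cover at most
\<open>|S| + 36\<close> points of \<open>S\<close> in total, counted with multiplicity. Conversely, an edge \<open>p\<close> of \<open>S\<close> must reach
all of \<open>S\<close> and \<open>U\<close>, while a vertex on \<open>x\<close> edges of \<open>S\<close> lies on at most \<open>4 - x\<close> edges of \<open>U\<close>; this forces
many triples of the \<open>H c\<close> at \<open>p\<close>. Summing over \<open>p\<close> and converting triples into matchings by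
\<open>triple_system_matching\<close> gives the inequality.\<close>

lemma quad_packing_bound:
  assumes KE: "K \<subseteq> E" and K4: "concurrency_le 4 K" and opt: "optimal K {4} (\<lambda>_. 1) Q"
  shows "card (K - \<Union>Q) * (4 * card K)
    \<le> card (K - \<Union>Q) * (5 * card Q + 10 * r + 4) + 36 * card Q"
proof -
  define S where "S = K - \<Union>Q"
  define U where "U = \<Union>Q"
  define H where "H = (\<lambda>c. {A. \<exists>v\<in>c. A = edges_at v S \<and> card A = 3})"
  have finK: "finite K" using KE finite_E finite_subset by blast
  have pack: "is_packing K {4} Q" using opt by (simp add: optimal_def)
  have finQ: "finite Q" and finU: "finite U" using finite_packing[OF finK pack] by (auto simp: U_def)
  have finS: "finite S" using finK by (simp add: S_def)
  have UK: "U \<subseteq> K" using pack by (auto simp: U_def is_packing_def)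
  have SK: "S \<subseteq> K" by (auto simp: S_def)
  have US: "U \<inter> S = {}" by (auto simp: U_def S_def)
  have cU: "card U = 4 * card Q"
  proof -
    have "(\<Sum>A\<in>Q. card A) = (\<Sum>A\<in>Q. 4)" using pack by (intro sum.cong) (auto simp: is_packing_def)
    then show ?thesis using card_Union_packing[OF finK pack] by (simp add: U_def)
  qed
  have cK: "card K = 4 * card Q + card S" using card_uniform_packing[OF finK pack] by (simp add: S_def)
  have S3: "concurrency_le 3 S"
    unfolding S_def using optimal_concurrency_le[OF finK opt, of 3] by simp
  have fin_at: "finite (edges_at v S)" "finite (edges_at v U)" for v
    using finS finU by (auto simp: edges_at_def)
  have at_sum: "card (edges_at v S) + card (edges_at v U) \<le> 4" for v
  proof -
    have "edges_at v S \<union> edges_at v U \<subseteq> edges_at v K" using SK UK by (auto simp: edges_at_def)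
    moreover have "finite (edges_at v K)" using finK by (simp add: edges_at_def)
    ultimately have "card (edges_at v S \<union> edges_at v U) \<le> 4"
      using K4 unfolding concurrency_le_def by (meson card_mono order_trans)
    moreover have "edges_at v S \<inter> edges_at v U = {}" using US by (auto simp: edges_at_def)
    ultimately show ?thesis using fin_at by (simp add: card_Un_disjoint)
  qed
  have H3: "card A = 3" if "A \<in> H c" for A c using that by (auto simp: H_def)
  have HS: "A \<subseteq> S" if "A \<in> H c" for A c using that by (auto simp: H_def edges_at_def)
  have finH: "finite (H c)" for c
    by (rule finite_subset[of _ "Pow S"]) (use HS finS in auto)
  have HUS: "\<Union>(H c) \<subseteq> S" for c using HS by blast
  have H_conc: "concurrent (insert c A)" if "A \<in> H c" for A c
    using that by (auto simp: H_def concurrent_def edges_at_def)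
  have "\<exists>M\<subseteq>H c. pairwise disjnt M \<and> card (\<Union>(H c)) \<le> card M + 2 * card (H c)" for c
    by (rule triple_system_matching[OF finH]) (rule H3)
  then obtain M where M: "\<And>c. M c \<subseteq> H c" "\<And>c. pairwise disjnt (M c)"
    "\<And>c. card (\<Union>(H c)) \<le> card (M c) + 2 * card (H c)" by metis
  have MS: "A \<subseteq> S" "finite A" if A: "A \<in> M c" for A c
  proof -
    show "A \<subseteq> S" using HS M(1) A by blast
    then show "finite A" using finS by (rule finite_subset)
  qed
  have M_size: "3 * card (M c) \<le> card S" for c
  proof -
    have "card (\<Union>(M c)) = (\<Sum>A\<in>M c. card A)"
      using M(2) MS by (intro card_Union_disjoint) auto
    also have "\<dots> = (\<Sum>A\<in>M c. 3)" using M(1) H3 by (intro sum.cong) auto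
    finally have "card (\<Union>(M c)) = 3 * card (M c)" by simp
    moreover have "\<Union>(M c) \<subseteq> S" using M(1) HS by blast
    ultimately show ?thesis using finS by (metis card_mono)
  qed
  have rival: "card (M b) \<le> 3" if B: "B \<in> Q" "a \<in> B" "b \<in> B" "a \<noteq> b" and A: "A \<in> M a" for a b A B
  proof (rule ccontr)
    assume "\<not> card (M b) \<le> 3"
    moreover have "card A = 3" using H3 M(1) A by blast
    ultimately have "card A < card (M b)" by simp
    then obtain A' where A': "A' \<in> M b" "A \<inter> A' = {}" using disjoint_member_of_large_matching[OF MS(2)[OF A] M(2)] by blast
    have AH: "A \<in> H a" "A' \<in> H b" using A A' M(1) by blast+
    have sub: "A \<subseteq> S" "A' \<subseteq> S" and finA: "finite A" and fin': "finite A'"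
      using MS A A'(1) by blast+
    have BS: "B \<inter> S = {}" using B(1) by (auto simp: S_def)
    have out: "a \<notin> A" "b \<notin> A'" "a \<notin> A'" "b \<notin> A" using B sub BS by blast+
    have dis: "insert a A \<inter> insert b A' = {}" using out A'(2) B(4) by blast
    have "is_packing (\<Union>{B} \<union> (K - \<Union>Q)) {4} {insert a A, insert b A'}"
      using H_conc[OF AH(1)] H_conc[OF AH(2)] B sub out dis finA fin' H3[OF AH(1)] H3[OF AH(2)]
      unfolding is_packing_def pairwise_insert disjnt_def by (auto simp: S_def)
    from optimal_exchange[OF finK _ opt _ this] B(1)
    have "weight (\<lambda>_. 1) {insert a A, insert b A'} \<le> weight (\<lambda>_. 1) {B}" by simp
    moreover have "a \<notin> insert b A'" using dis by auto
    then have "insert a A \<noteq> insert b A'" by (metis insertI1)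
    ultimately show False by (simp add: weight_def)
  qed
  have per_block: "(\<Sum>c\<in>B. 3 * card (M c)) \<le> card S + 36" if B: "B \<in> Q" for B
  proof -
    have B4: "card B = 4" using B pack by (auto simp: is_packing_def)
    have finB: "finite B" using B4 by (auto intro: card_ge_0_finite)
    show ?thesis
    proof (cases "\<forall>c\<in>B. card (M c) \<le> 3")
      case True
      then have "(\<Sum>c\<in>B. 3 * card (M c)) \<le> (\<Sum>c\<in>B. 9)" by (intro sum_mono) auto
      then show ?thesis using B4 by simp
    next
      case False
      then obtain b where b: "b \<in> B" "\<not> card (M b) \<le> 3" by blast
      have "M a = {}" if "a \<in> B - {b}" for a using rival[OF B, of a b] that b by blast
      then have "(\<Sum>c\<in>B - {b}. 3 * card (M c)) = 0" by simp
      then have "(\<Sum>c\<in>B. 3 * card (M c)) = 3 * card (M b)"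
        using sum.remove[OF finB b(1), of "\<lambda>c. 3 * card (M c)"] by simp
      then show ?thesis using M_size[of b] by simp
    qed
  qed
  \<comment> \<open>\<open>y p\<close> counts the covered edges that form a quadruple with \<open>p\<close> and two more edges of \<open>S\<close>;
    \<open>\<alpha> p\<close> counts the vertices of \<open>p\<close> on three edges of \<open>S\<close>\<close>
  define y where "y = (\<lambda>p. card {c\<in>U. p \<in> \<Union>(H c)})"
  define \<alpha> where "\<alpha> = (\<lambda>p. card {v\<in>p. card (edges_at v S) = 3})"
  have reach: "12 * card Q + 4 * card S + 2 * \<alpha> p \<le> 3 * y p + 10 * r + 4" if p: "p \<in> S" for p
  proof -
    define x where "x = (\<lambda>v. card (edges_at v S))"
    define low where "low = (\<lambda>v. if x v \<le> 2 then 4 - x v else 0)"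
    have pE: "p \<in> E" using p SK KE by blast
    have finp: "finite p" using finite_edge[OF pE] .
    have "U \<subseteq> {c\<in>U. p \<in> \<Union>(H c)} \<union> (\<Union>v\<in>{v\<in>p. x v \<le> 2}. edges_at v U)"
    proof
      fix c assume c: "c \<in> U"
      then obtain v where v: "v \<in> p" "v \<in> c" using meets[OF pE, of c] UK KE by blast
      have "x v \<le> 3" using S3 by (simp add: x_def concurrency_le_def)
      then consider "x v \<le> 2" | "x v = 3" by linarith
      then show "c \<in> {c\<in>U. p \<in> \<Union>(H c)} \<union> (\<Union>v\<in>{v\<in>p. x v \<le> 2}. edges_at v U)"
      proof cases
        case 1
        then show ?thesis using c v by (auto simp: edges_at_def)
      next
        case 2
        then have "edges_at v S \<in> H c" using v by (auto simp: H_def x_def)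
        moreover have "p \<in> edges_at v S" using v p by (simp add: edges_at_def)
        ultimately show ?thesis using c by blast
      qed
    qed
    then have "card U \<le> card ({c\<in>U. p \<in> \<Union>(H c)} \<union> (\<Union>v\<in>{v\<in>p. x v \<le> 2}. edges_at v U))"
      using finU finp fin_at by (intro card_mono) auto
    also have "\<dots> \<le> y p + card (\<Union>v\<in>{v\<in>p. x v \<le> 2}. edges_at v U)"
      unfolding y_def by (rule card_Un_le)
    also have "card (\<Union>v\<in>{v\<in>p. x v \<le> 2}. edges_at v U) \<le> (\<Sum>v\<in>{v\<in>p. x v \<le> 2}. card (edges_at v U))"
      using finp by (intro card_UN_le) simp
    also have "\<dots> \<le> (\<Sum>v\<in>{v\<in>p. x v \<le> 2}. 4 - x v)"
      using at_sum unfolding x_def by (intro sum_mono) (simp add: le_diff_conv2 add.commute)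
    also have "\<dots> = (\<Sum>v\<in>p. low v)" using finp by (simp add: low_def sum.inter_filter)
    finally have reachU: "4 * card Q \<le> y p + (\<Sum>v\<in>p. low v)" using cU by simp
    have "S - {p} \<subseteq> (\<Union>v\<in>p. edges_at v S - {p})"
    proof
      fix e assume e: "e \<in> S - {p}"
      then obtain v where "v \<in> p" "v \<in> e" using meets[OF pE, of e] SK KE by blast
      then show "e \<in> (\<Union>v\<in>p. edges_at v S - {p})" using e by (auto simp: edges_at_def)
    qed
    then have "card (S - {p}) \<le> card (\<Union>v\<in>p. edges_at v S - {p})"
      using finp fin_at by (intro card_mono) auto
    also have "\<dots> \<le> (\<Sum>v\<in>p. card (edges_at v S - {p}))" using finp by (rule card_UN_le)
    also have "\<dots> = (\<Sum>v\<in>p. x v - 1)"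
      using p by (intro sum.cong) (auto simp: x_def edges_at_def)
    finally have reachS: "card S \<le> (\<Sum>v\<in>p. x v - 1) + 1" using p finS by simp
    have \<alpha>: "\<alpha> p = (\<Sum>v\<in>p. if x v = 3 then 1 else 0)"
      using finp by (simp add: \<alpha>_def x_def sum.If_cases Int_def)
    \<comment> \<open>with these weights, each vertex of \<open>p\<close> contributes at most 10, whether it is on one, two or three edges of
      \<open>S\<close>\<close>
    have "3 * (\<Sum>v\<in>p. low v) + 4 * (\<Sum>v\<in>p. x v - 1) + 2 * \<alpha> p
        = (\<Sum>v\<in>p. 3 * low v + 4 * (x v - 1) + 2 * (if x v = 3 then 1 else 0))"
      by (simp add: \<alpha> sum.distrib sum_distrib_left)
    also have "\<dots> \<le> (\<Sum>v\<in>p. 10)"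
    proof (rule sum_mono)
      fix v assume v: "v \<in> p"
      have "p \<in> edges_at v S" using v p by (simp add: edges_at_def)
      then have "1 \<le> x v" using fin_at unfolding x_def by (metis card_0_eq empty_iff less_one not_le)
      moreover have "x v \<le> 3" using S3 by (simp add: x_def concurrency_le_def)
      ultimately have "x v = 1 \<or> x v = 2 \<or> x v = 3" by linarith
      then show "3 * low v + 4 * (x v - 1) + 2 * (if x v = 3 then 1 else 0) \<le> 10"
        by (auto simp: low_def)
    qed
    also have "\<dots> = 10 * r" using card_edge[OF pE] by simp
    finally show ?thesis using reachU reachS by linarith
  qed
  have y_sum: "(\<Sum>p\<in>S. y p) = (\<Sum>c\<in>U. card (\<Union>(H c)))"
  proof -
    have "(\<Sum>p\<in>S. y p) = (\<Sum>p\<in>S. \<Sum>c\<in>U. if p \<in> \<Union>(H c) then 1 else 0)"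
      using finU by (simp add: y_def sum.If_cases Int_def)
    also have "\<dots> = (\<Sum>c\<in>U. \<Sum>p\<in>S. if p \<in> \<Union>(H c) then 1 else 0)" by (rule sum.swap)
    also have "\<dots> = (\<Sum>c\<in>U. card (\<Union>(H c)))"
    proof (rule sum.cong)
      fix c
      have "S \<inter> {p. p \<in> \<Union>(H c)} = \<Union>(H c)" using HUS by blast
      then show "(\<Sum>p\<in>S. if p \<in> \<Union>(H c) then 1 else 0) = card (\<Union>(H c))"
        using finS by (simp only: sum.If_cases) simp
    qed simp
    finally show ?thesis .
  qed
  have \<alpha>_sum: "(\<Sum>c\<in>U. 3 * card (H c)) \<le> (\<Sum>p\<in>S. \<alpha> p)"
  proof -
    define full where "full = {v. card (edges_at v S) = 3}"
    have fin_vc: "finite c" if "c \<in> U" for c using that UK KE by (intro finite_edge) blast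
    have H_le: "3 * card (H c) \<le> (\<Sum>p\<in>S. card (p \<inter> c \<inter> full))" if c: "c \<in> U" for c
    proof -
      have "H c = (\<lambda>v. edges_at v S) ` (c \<inter> full)" by (auto simp: H_def full_def)
      then have "3 * card (H c) \<le> 3 * card (c \<inter> full)"
        using card_image_le[of "c \<inter> full" "\<lambda>v. edges_at v S"] fin_vc[OF c] by simp
      also have "\<dots> = (\<Sum>v\<in>c \<inter> full. card (edges_at v S))" by (simp add: full_def)
      also have "\<dots> = (\<Sum>v\<in>c \<inter> full. \<Sum>p\<in>S. if v \<in> p then 1 else 0)"
        using finS by (simp add: sum.If_cases edges_at_def Int_def)
      also have "\<dots> = (\<Sum>p\<in>S. \<Sum>v\<in>c \<inter> full. if v \<in> p then 1 else 0)" by (rule sum.swap)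
      also have "\<dots> = (\<Sum>p\<in>S. card (p \<inter> c \<inter> full))"
      proof (rule sum.cong)
        fix p
        have "c \<inter> full \<inter> {v. v \<in> p} = p \<inter> c \<inter> full" by blast
        then show "(\<Sum>v\<in>c \<inter> full. if v \<in> p then 1 else 0) = card (p \<inter> c \<inter> full)"
          using fin_vc[OF c] by (simp add: sum.If_cases)
      qed simp
      finally show ?thesis .
    qed
    \<comment> \<open>a vertex on three edges of \<open>S\<close> is on at most one covered edge, so no triple is counted for two edges
      \<open>c\<close>\<close>
    have one_owner: "c = c'" if "c \<in> U" "c' \<in> U" "v \<in> c" "v \<in> c'" "v \<in> full" for c c' v
    proof -
      have "card (edges_at v U) \<le> 1" using at_sum[of v] that(5) by (simp add: full_def)
      moreover have "c \<in> edges_at v U" "c' \<in> edges_at v U" using that by (auto simp: edges_at_def)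
      ultimately show ?thesis using fin_at(2) card_le_Suc0_iff_eq by (metis One_nat_def)
    qed
    have "(\<Sum>c\<in>U. 3 * card (H c)) \<le> (\<Sum>c\<in>U. \<Sum>p\<in>S. card (p \<inter> c \<inter> full))"
      using H_le by (rule sum_mono)
    also have "\<dots> = (\<Sum>p\<in>S. \<Sum>c\<in>U. card (p \<inter> c \<inter> full))" by (rule sum.swap)
    also have "\<dots> \<le> (\<Sum>p\<in>S. \<alpha> p)"
    proof (rule sum_mono)
      fix p assume p: "p \<in> S"
      have finp: "finite p" using finite_edge p SK KE by blast
      have "(\<Sum>c\<in>U. card (p \<inter> c \<inter> full)) = card (\<Union>c\<in>U. p \<inter> c \<inter> full)"
      proof (rule card_UN_disjoint[symmetric])
        show "\<forall>c\<in>U. \<forall>c'\<in>U. c \<noteq> c' \<longrightarrow> p \<inter> c \<inter> full \<inter> (p \<inter> c' \<inter> full) = {}"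
          using one_owner by blast
      qed (use finU finp in auto)
      also have "\<dots> \<le> \<alpha> p" unfolding \<alpha>_def using finp by (intro card_mono) (auto simp: full_def)
      finally show "(\<Sum>c\<in>U. card (p \<inter> c \<inter> full)) \<le> \<alpha> p" .
    qed
    finally show ?thesis .
  qed
  have M_sum: "(\<Sum>c\<in>U. 3 * card (M c)) \<le> card Q * (card S + 36)"
  proof -
    have "(\<Sum>c\<in>U. 3 * card (M c)) = (\<Sum>B\<in>Q. \<Sum>c\<in>B. 3 * card (M c))"
      proof -
      have "\<forall>A\<in>Q. finite A" using pack finite_subset[OF _ finK] by (auto simp: is_packing_def)
      moreover have "\<forall>A\<in>Q. \<forall>B\<in>Q. A \<noteq> B \<longrightarrow> A \<inter> B = {}"
        using pack by (auto simp: is_packing_def pairwise_def disjnt_def)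
      ultimately show ?thesis unfolding U_def by (simp add: sum.Union_disjoint)
    qed
    also have "\<dots> \<le> (\<Sum>B\<in>Q. card S + 36)" using per_block by (rule sum_mono)
    finally show ?thesis by simp
  qed
  have "(\<Sum>p\<in>S. 12 * card Q + 4 * card S + 2 * \<alpha> p) \<le> (\<Sum>p\<in>S. 3 * y p + 10 * r + 4)"
    using reach by (rule sum_mono)
  then have "card S * (12 * card Q + 4 * card S) + 2 * (\<Sum>p\<in>S. \<alpha> p)
      \<le> 3 * (\<Sum>p\<in>S. y p) + card S * (10 * r + 4)"
    by (simp add: sum.distrib sum_distrib_left sum_distrib_right algebra_simps)
  moreover have "(\<Sum>c\<in>U. card (\<Union>(H c))) \<le> (\<Sum>c\<in>U. card (M c) + 2 * card (H c))"
    using M(3) by (rule sum_mono)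
  then have "3 * (\<Sum>p\<in>S. y p) \<le> (\<Sum>c\<in>U. 3 * card (M c)) + 2 * (\<Sum>c\<in>U. 3 * card (H c))"
    unfolding y_sum by (simp add: sum.distrib sum_distrib_left[symmetric])
  ultimately have "card S * (12 * card Q + 4 * card S)
      \<le> card Q * (card S + 36) + card S * (10 * r + 4)"
    using \<alpha>_sum M_sum by linarith
  then show ?thesis by (simp add: S_def[symmetric] cK algebra_simps)
qed

end

section \<open>Packings of maximum weight\<close>

context intersecting_family begin

text \<open>The weights 2 for a triple and 5 for a quadruple are chosen for this exchange. Suppose that disjoint
pairs of uncovered edges reach \<open>|B| - 1\<close> edges of \<open>B\<close>. Each pair that is used takes one or two of these
edges and forms a triple or a quadruple (no five edges are concurrent), which weighs at least twice the number of edges taken. The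
total is at least \<open>2 (|B| - 1)\<close>, that is 4 against 2 for a triple \<open>B\<close> and 6 against 5 for a quadruple \<open>B\<close>.\<close>

lemma matching_labels_bound:
  assumes KE: "K \<subseteq> E" and K4: "concurrency_le 4 K"
    and opt: "optimal K {3, 4} (\<lambda>n. if n = 4 then 5 else 2) P" and B: "B \<in> P"
    and M: "is_matching (K - \<Union>P) M"
  shows "card (\<Union>e\<in>M. edges_at (meet e) (\<Union>P) \<inter> B) \<le> card B - 2"
proof (rule ccontr)
  assume neg: "\<not> ?thesis"
  define R where "R = K - \<Union>P"
  define Y where "Y = (\<lambda>e. edges_at (meet e) (\<Union>P) \<inter> B)"
  let ?w = "\<lambda>n :: nat. if n = 4 then 5 else 2 :: nat"
  have finK: "finite K" using KE finite_E finite_subset by blast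
  have pack: "is_packing K {3, 4} P" using opt by (simp add: optimal_def)
  have UK: "\<Union>P \<subseteq> K" using pack by (auto simp: is_packing_def)
  have RK: "R \<subseteq> K" and UR: "K - R = \<Union>P" using UK by (auto simp: R_def)
  have BK: "B \<subseteq> K" and BR: "B \<inter> R = {}" using B UK by (auto simp: R_def)
  have B34: "card B = 3 \<or> card B = 4" using B pack by (auto simp: is_packing_def)
  obtain L where L: "L \<subseteq> (\<Union>e\<in>M. Y e)" "card L = card B - 1" "finite L"
  proof -
    have "card B - 1 \<le> card (\<Union>e\<in>M. Y e)" using neg B34 by (auto simp: Y_def)
    then show ?thesis using that obtain_subset_with_card_n by metis
  qed
  then have "\<forall>l\<in>L. \<exists>e\<in>M. l \<in> Y e" by blast
  then obtain g where g: "\<And>l. l \<in> L \<Longrightarrow> g l \<in> M" "\<And>l. l \<in> L \<Longrightarrow> l \<in> Y (g l)" by metis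
  define fib where "fib = (\<lambda>e. {l\<in>L. g l = e})"
  define N where "N = (\<lambda>e. e \<union> fib e) ` (g ` L)"
  have edge: "e \<subseteq> R" "card e = 2" "finite e" "e \<in> M" if e: "e \<in> g ` L" for e
  proof -
    show "e \<in> M" using e g(1) by blast
    then show "e \<subseteq> R" "card e = 2" using M by (auto simp: is_matching_def R_def)
    then show "finite e" by (auto intro: card_ge_0_finite)
  qed
  have fibY: "fib e \<subseteq> Y e" for e using g by (auto simp: fib_def)
  have fibB: "fib e \<subseteq> B" for e using fibY by (auto simp: Y_def)
  have finfib: "finite (fib e)" for e using L(3) by (simp add: fib_def)
  have conc: "concurrent (e \<union> fib e)" if e: "e \<in> g ` L" for e
  proof (rule concurrent_subset[OF concurrent_pair_with_labels[OF KE RK edge(1)[OF e] edge(2)[OF e]]])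
    show "e \<union> fib e \<subseteq> e \<union> edges_at (meet e) (K - R)"
      using fibY[of e] unfolding Y_def UR by blast
  qed
  have cardN: "card (e \<union> fib e) = 2 + card (fib e)" if e: "e \<in> g ` L" for e
    using edge[OF e] fibB[of e] BR finfib[of e] by (subst card_Un_disjoint) auto
  have fib_le: "card (fib e) \<le> 2" if e: "e \<in> g ` L" for e
  proof -
    have "e \<union> fib e \<subseteq> K" using edge(1)[OF e] RK fibB BK by blast
    then have "card (e \<union> fib e) \<le> 4" using concurrency_leD[OF K4 finK _ conc[OF e]] by blast
    then show ?thesis using cardN[OF e] by simp
  qed
  have fib_ge: "1 \<le> card (fib e)" if e: "e \<in> g ` L" for e
  proof -
    have "fib e \<noteq> {}" using e by (auto simp: fib_def)
    then show ?thesis using finfib[of e] by (simp add: Suc_le_eq card_gt_0_iff)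
  qed
  have apart: "(e \<union> fib e) \<inter> (f \<union> fib f) = {}" if ef: "e \<in> g ` L" "f \<in> g ` L" "e \<noteq> f" for e f
  proof -
    have "e \<inter> f = {}"
      using edge(4)[OF ef(1)] edge(4)[OF ef(2)] ef(3) M by (auto simp: is_matching_def pairwise_def disjnt_def)
    moreover have "fib e \<inter> fib f = {}" using ef(3) by (auto simp: fib_def)
    ultimately show ?thesis
      using edge(1)[OF ef(1)] edge(1)[OF ef(2)] fibB[of e] fibB[of f] BR by blast
  qed
  have inj: "inj_on (\<lambda>e. e \<union> fib e) (g ` L)"
  proof (rule inj_onI)
    fix e f assume ef: "e \<in> g ` L" "f \<in> g ` L" "e \<union> fib e = f \<union> fib f"
    have "(e \<union> fib e) \<inter> R = e" "(f \<union> fib f) \<inter> R = f"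
      using edge(1)[OF ef(1)] edge(1)[OF ef(2)] fibB[of e] fibB[of f] BR by blast+
    then show "e = f" using ef(3) by metis
  qed
  have "is_packing (\<Union>{B} \<union> (K - \<Union>P)) {3, 4} N"
    unfolding is_packing_def
  proof (intro conjI ballI pairwiseI)
    fix A assume "A \<in> N"
    then obtain e where e: "e \<in> g ` L" "A = e \<union> fib e" by (auto simp: N_def)
    show "A \<subseteq> \<Union>{B} \<union> (K - \<Union>P)" using e(2) edge(1)[OF e(1)] fibB[of e] by (auto simp: R_def)
    show "card A \<in> {3, 4}" using cardN[OF e(1)] fib_le[OF e(1)] fib_ge[OF e(1)] e(2) by auto
    show "concurrent A" using conc[OF e(1)] e(2) by simp
  next
    fix A A' assume AA: "A \<in> N" "A' \<in> N" "A \<noteq> A'"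
    obtain e where e: "e \<in> g ` L" "A = e \<union> fib e" using AA(1) by (auto simp: N_def)
    obtain f where f: "f \<in> g ` L" "A' = f \<union> fib f" using AA(2) by (auto simp: N_def)
    have "e \<noteq> f" using AA(3) e(2) f(2) by blast
    then show "disjnt A A'" using apart[OF e(1) f(1)] e(2) f(2) by (simp add: disjnt_def)
  qed
  from optimal_exchange[OF finK _ opt _ this] B have "weight ?w N \<le> weight ?w {B}" by simp
  also have "\<dots> < 2 * card L" using B34 L(2) by (auto simp: weight_def)
  also have "\<dots> = (\<Sum>e\<in>g ` L. 2 * card (fib e))"
    using sum.image_gen[OF L(3), of "\<lambda>_. 1 :: nat" g] by (simp add: fib_def sum_distrib_left[symmetric])
  also have "\<dots> \<le> (\<Sum>e\<in>g ` L. ?w (card (e \<union> fib e)))"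
  proof (rule sum_mono)
    fix e assume e: "e \<in> g ` L"
    have "card (fib e) = 1 \<or> card (fib e) = 2" using fib_le[OF e] fib_ge[OF e] by linarith
    then show "2 * card (fib e) \<le> ?w (card (e \<union> fib e))" using cardN[OF e] by auto
  qed
  also have "\<dots> = weight ?w N" unfolding weight_def N_def using inj by (simp add: sum.reindex)
  finally show False by simp
qed

end

text \<open>The constant comes from \<open>few_vertices_see_many_labels\<close> and depends on nothing but the block sizes 3 and 4,
so it is the same for all hypergraphs; the asymptotic bound relies on this uniformity.\<close>

lemma mixed_packing_bound:
  "\<exists>C. \<forall>(E :: 'a set set) r K P. intersecting_family E r \<longrightarrow> K \<subseteq> E \<longrightarrow> concurrency_le 4 K \<longrightarrow>
    optimal K {3, 4} (\<lambda>n. if n = 4 then 5 else 2) P \<longrightarrow>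
    card (K - \<Union>P) * (card K + 2 * card (K - \<Union>P))
      \<le> card (K - \<Union>P) * ((\<Sum>A\<in>P. card A - 2) + 3 * r + 3) + C * card P"
proof -
  obtain C1 where C1: "\<And>(R :: 'a set set) (Y :: 'a set set \<Rightarrow> 'a set set) B.
    \<lbrakk>finite R; finite B; card B \<le> 3; \<forall>e. Y e \<subseteq> B;
     \<forall>M. is_matching R M \<longrightarrow> card (\<Union>(Y ` M)) \<le> 1\<rbrakk> \<Longrightarrow>
    card {p\<in>R. 1 < card (labels_at R Y p)} \<le> C1"
    using few_vertices_see_many_labels[of 3 1] by blast
  obtain C2 where C2: "\<And>(R :: 'a set set) (Y :: 'a set set \<Rightarrow> 'a set set) B.
    \<lbrakk>finite R; finite B; card B \<le> 4; \<forall>e. Y e \<subseteq> B;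
     \<forall>M. is_matching R M \<longrightarrow> card (\<Union>(Y ` M)) \<le> 2\<rbrakk> \<Longrightarrow>
    card {p\<in>R. 2 < card (labels_at R Y p)} \<le> C2"
    using few_vertices_see_many_labels[of 4 2] by blast
  show ?thesis
  proof (intro exI[of _ "4 * max C1 C2"] allI impI)
    fix E :: "'a set set" and r K P
    assume "intersecting_family E r"
      and KE: "K \<subseteq> E" and K4: "concurrency_le 4 K"
      and opt: "optimal K {3, 4} (\<lambda>n. if n = 4 then 5 else 2) P"
    then interpret intersecting_family E r by simp
    define R where "R = K - \<Union>P"
    define Y where "Y = (\<lambda>e. edges_at (meet e) (\<Union>P))"
    have finK: "finite K" using KE finite_E finite_subset by blast
    have pack: "is_packing K {3, 4} P" using opt by (simp add: optimal_def)
    have UK: "\<Union>P \<subseteq> K" using pack by (auto simp: is_packing_def)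
    have RK: "R \<subseteq> K" and UR: "K - R = \<Union>P" and finR: "finite R" using UK finK by (auto simp: R_def)
    have finP: "finite P" "finite (\<Union>P)" using finite_packing[OF finK pack] by auto
    have R2: "concurrency_le 2 R"
      unfolding R_def using optimal_concurrency_le[OF finK opt, of 2] by simp
    have K4': "concurrency_le (Suc 3) K" using K4 by simp
    have per_block: "(\<Sum>p\<in>R. card (labels_at R (\<lambda>e. Y e \<inter> B) p))
        \<le> (card B - 2) * card R + 4 * max C1 C2" if B: "B \<in> P" for B
    proof -
      have B34: "card B = 3 \<or> card B = 4" using B pack by (auto simp: is_packing_def)
      then have finB: "finite B" by (auto intro: card_ge_0_finite)
      have mat: "\<forall>M. is_matching R M \<longrightarrow> card (\<Union>e\<in>M. Y e \<inter> B) \<le> card B - 2"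
        using matching_labels_bound[OF KE K4 opt B] by (simp add: Y_def R_def)
      have "card {p\<in>R. card B - 2 < card (labels_at R (\<lambda>e. Y e \<inter> B) p)} \<le> max C1 C2"
        using B34
      proof
        assume "card B = 3"
        then show ?thesis using C1[OF finR finB, of "\<lambda>e. Y e \<inter> B"] mat by (simp add: le_max_iff_disj)
      next
        assume "card B = 4"
        then show ?thesis using C2[OF finR finB, of "\<lambda>e. Y e \<inter> B"] mat by (simp add: le_max_iff_disj)
      qed
      from sum_labels_le_of_few_exceptions[OF finR finB this]
      have "(\<Sum>p\<in>R. card (labels_at R (\<lambda>e. Y e \<inter> B) p))
        \<le> (card B - 2) * card R + card B * max C1 C2" by simp
      also have "\<dots> \<le> (card B - 2) * card R + 4 * max C1 C2"
        using B34 by (intro add_left_mono mult_right_mono) auto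
      finally show ?thesis .
    qed
    have "card (K - R) + card R = card K"
      using card_Diff_subset[OF finR RK] card_mono[OF finK RK] by simp
    then have reach: "card K + 2 * card R \<le> card (labels_at R Y p) + 3 * (r + 1)" if "p \<in> R" for p
      using reach_count[OF KE RK R2 K4' that] unfolding Y_def UR by linarith
    have "card R * (card K + 2 * card R) = (\<Sum>p\<in>R. card K + 2 * card R)" by simp
    also have "\<dots> \<le> (\<Sum>p\<in>R. card (labels_at R Y p) + 3 * (r + 1))" using reach by (rule sum_mono)
    also have "\<dots> = (\<Sum>p\<in>R. card (labels_at R Y p)) + card R * (3 * r + 3)"
      by (simp add: sum.distrib)
    also have "(\<Sum>p\<in>R. card (labels_at R Y p)) \<le> (\<Sum>B\<in>P. \<Sum>p\<in>R. card (labels_at R (\<lambda>e. Y e \<inter> B) p))"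
      using sum_labels_le[OF finP, of Y R] by (auto simp: Y_def edges_at_def)
    also have "\<dots> \<le> (\<Sum>B\<in>P. (card B - 2) * card R + 4 * max C1 C2)" using per_block by (rule sum_mono)
    also have "\<dots> = (\<Sum>B\<in>P. card B - 2) * card R + 4 * max C1 C2 * card P"
      by (simp add: sum.distrib sum_distrib_right)
    finally show "card (K - \<Union>P) * (card K + 2 * card (K - \<Union>P))
      \<le> card (K - \<Union>P) * ((\<Sum>A\<in>P. card A - 2) + 3 * r + 3) + 4 * max C1 C2 * card P"
      by (simp add: R_def[symmetric] algebra_simps)
  qed
qed

section \<open>Combining the packings\<close>

text \<open>The error terms of \<open>quad_packing_bound\<close> and \<open>mixed_packing_bound\<close> have the form of a
constant times the number of blocks over the number of uncovered edges. If the number of uncovered edges is at least a fixed fraction of \<open>r\<close>, they are bounded. Otherwise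
the inequalities hold anyway, since then enough of the at most \<open>3 r + 1\<close> edges are packed
(\<open>quad'\<close> and \<open>mixed'\<close> below). What remains is a linear programme in the sizes of the packings.\<close>

lemma edge_count_ge_55_18:
  "\<exists>C. \<forall>(E :: 'a set set) r. cover_critical_family E r \<longrightarrow> 55 * real r \<le> 18 * real (card E) + C"
proof -
  let ?w = "\<lambda>n :: nat. if n = 4 then 5 else 2 :: nat"
  obtain D where D: "\<And>(E :: 'a set set) r K P. \<lbrakk>intersecting_family E r; K \<subseteq> E; concurrency_le 4 K;
      optimal K {3, 4} ?w P\<rbrakk> \<Longrightarrow>
    card (K - \<Union>P) * (card K + 2 * card (K - \<Union>P))
      \<le> card (K - \<Union>P) * ((\<Sum>A\<in>P. card A - 2) + 3 * r + 3) + D * card P"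
    using mixed_packing_bound by blast
  show ?thesis
  proof (intro exI[of _ "2000 + 2000 * real D"] allI impI)
    fix E :: "'a set set" and r
    assume "cover_critical_family E r"
    then interpret cover_critical_family E r .
    obtain F where F: "optimal E {5} (\<lambda>_. 1) F" using optimal_exists[OF finite_E] by blast
    define K where "K = E - \<Union>F"
    have KE: "K \<subseteq> E" and finK: "finite K" using finite_E by (auto simp: K_def)
    obtain Q where Q: "optimal K {4} (\<lambda>_. 1) Q" using optimal_exists[OF finK] by blast
    define S where "S = K - \<Union>Q"
    have SE: "S \<subseteq> E" and finS: "finite S" using finK KE by (auto simp: S_def)
    obtain T where T: "optimal S {3} (\<lambda>_. 1) T" using optimal_exists[OF finS] by blast
    obtain P where P: "optimal K {3, 4} ?w P" using optimal_exists[OF finK] by blast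
    have pF: "is_packing E {5} F" and pQ: "is_packing K {4} Q" and pT: "is_packing S {3} T"
      and pP: "is_packing K {3, 4} P"
      using F Q T P by (auto simp: optimal_def)
    have fin: "finite F" "finite Q" "finite T" "finite P"
      using finite_packing(1) finite_E finK finS pF pQ pT pP by blast+
    have K4: "concurrency_le 4 K"
      unfolding K_def using optimal_concurrency_le[OF finite_E F, of 4] by simp
    have S3: "concurrency_le 3 S"
      unfolding S_def using optimal_concurrency_le[OF finK Q, of 3] by simp
    define P3 P4 where "P3 = {A\<in>P. card A = 3}" and "P4 = {A\<in>P. card A = 4}"
    have P34: "P = P3 \<union> P4" "P3 \<inter> P4 = {}" "finite P3" "finite P4"
      using pP fin by (auto simp: P3_def P4_def is_packing_def)
    have sumP: "(\<Sum>A\<in>P. f (card A)) = f 3 * card P3 + f 4 * card P4" for f :: "nat \<Rightarrow> nat"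
    proof -
      have "(\<Sum>A\<in>P. f (card A)) = (\<Sum>A\<in>P3. f (card A)) + (\<Sum>A\<in>P4. f (card A))"
        using P34 by (metis sum.union_disjoint)
      also have "(\<Sum>A\<in>P3. f (card A)) = (\<Sum>A\<in>P3. f 3)" by (intro sum.cong) (auto simp: P3_def)
      also have "(\<Sum>A\<in>P4. f (card A)) = (\<Sum>A\<in>P4. f 4)" by (intro sum.cong) (auto simp: P4_def)
      finally show ?thesis by simp
    qed
    define \<kappa> \<sigma> \<rho>' \<rho> where "\<kappa> = card K" and "\<sigma> = card S" and "\<rho>' = card (S - \<Union>T)"
      and "\<rho> = card (K - \<Union>P)"
    define m f q' t' q t where "m = card E" and "f = card F" and "q' = card Q" and "t' = card T"
      and "q = card P4" and "t = card P3"
    have m: "m = 5 * f + \<kappa>"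
      using card_uniform_packing[OF finite_E pF] by (simp add: m_def f_def \<kappa>_def K_def)
    have \<kappa>: "\<kappa> = 4 * q' + \<sigma>"
      using card_uniform_packing[OF finK pQ] by (simp add: \<kappa>_def q'_def \<sigma>_def S_def)
    have \<sigma>: "\<sigma> = 3 * t' + \<rho>'"
      using card_uniform_packing[OF finS pT] by (simp add: \<sigma>_def t'_def \<rho>'_def)
    have \<kappa>': "\<kappa> = 4 * q + 3 * t + \<rho>"
      using card_packing_split[OF finK pP] sumP[of "\<lambda>n. n"] by (simp add: \<kappa>_def q_def t_def \<rho>_def)
    have cP: "card P = q + t" using sumP[of "\<lambda>_. 1"] by (simp add: q_def t_def)
    have \<kappa>_le: "\<kappa> \<le> 3 * r + 1"
      using card_le_concurrency[OF KE, of 3] K4 by (simp add: \<kappa>_def)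
    have triple: "t' + \<rho>' \<le> r + 2"
      using triple_packing_bound[OF SE S3 T] by (simp add: t'_def \<rho>'_def)
    have quad: "\<sigma> * (4 * \<kappa>) \<le> \<sigma> * (5 * q' + 10 * r + 4) + 36 * q'"
      using quad_packing_bound[OF KE K4 Q] by (simp add: \<sigma>_def S_def \<kappa>_def q'_def)
    have mixed: "\<rho> * (\<kappa> + 2 * \<rho>) \<le> \<rho> * (2 * q + t + 3 * r + 3) + D * (q + t)"
      using D[OF intersecting_family_axioms KE K4 P] cP sumP[of "\<lambda>n. n - 2"]
      by (simp add: \<rho>_def \<kappa>_def q_def t_def algebra_simps)
    have QT: "is_packing K ({4} \<union> {3}) (Q \<union> T)" "Q \<inter> T = {}"
      using packing_extend[OF pQ, of "{3}" T] pT by (auto simp: S_def)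
    have "weight ?w (Q \<union> T) \<le> weight ?w P" using P QT(1) by (simp add: optimal_def insert_commute)
    moreover have "weight ?w (Q \<union> T) = 5 * q' + 2 * t'"
    proof -
      have "weight ?w (Q \<union> T) = (\<Sum>A\<in>Q. ?w (card A)) + (\<Sum>A\<in>T. ?w (card A))"
        unfolding weight_def using fin QT(2) by (simp add: sum.union_disjoint)
      also have "(\<Sum>A\<in>Q. ?w (card A)) = (\<Sum>A\<in>Q. 5)"
        using pQ by (intro sum.cong) (auto simp: is_packing_def)
      also have "(\<Sum>A\<in>T. ?w (card A)) = (\<Sum>A\<in>T. 2)"
        using pT by (intro sum.cong) (auto simp: is_packing_def)
      finally show ?thesis by (simp add: q'_def t'_def)
    qed
    moreover have "weight ?w P = 5 * q + 2 * t"
      unfolding weight_def using sumP[of ?w] by (simp add: q_def t_def)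
    ultimately have exch: "5 * q' + 2 * t' \<le> 5 * q + 2 * t" by simp
    have cover: "r \<le> f + card X + (card (K - \<Union>X) + 1) div 2" if X: "is_packing K {3, 4} X" for X
    proof -
      have ext: "is_packing E ({5} \<union> {3, 4}) (F \<union> X)" "F \<inter> X = {}"
        using packing_extend[OF pF, of "{3, 4}" X] X by (auto simp: K_def)
      have "E - \<Union>(F \<union> X) = K - \<Union>X" by (auto simp: K_def)
      moreover have "card (F \<union> X) = f + card X"
        using ext(2) fin(1) finite_packing(1)[OF finK X] by (simp add: card_Un_disjoint f_def)
      ultimately show ?thesis using packing_cover[OF ext(1)] by simp
    qed
    have cov: "r \<le> f + q + t + (\<rho> + 1) div 2" using cover[OF pP] cP by (simp add: \<rho>_def)
    have cov': "r \<le> f + q' + t' + (\<rho>' + 1) div 2"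
    proof -
      have "K - \<Union>(Q \<union> T) = S - \<Union>T" by (auto simp: S_def)
      moreover have "card (Q \<union> T) = q' + t'"
        using QT(2) fin by (simp add: card_Un_disjoint q'_def t'_def)
      ultimately show ?thesis using cover[of "Q \<union> T"] QT(1) by (simp add: \<rho>'_def insert_commute)
    qed
    have r1: "1 \<le> r" by (rule r_pos)
    \<comment> \<open>failure would leave \<open>19 \<sigma> \<le> 9 q'\<close>, hence \<open>\<sigma> < r / 2\<close>, and then \<open>q'\<close>
      alone makes the right side large enough\<close>
    have quad': "4 * \<kappa> \<le> 5 * q' + 10 * r + 80"
    proof (rule ccontr)
      assume neg: "\<not> ?thesis"
      then have "5 * q' + 10 * r + 4 + 76 \<le> 4 * \<kappa>" by simp
      then have "\<sigma> * (5 * q' + 10 * r + 4 + 76) \<le> \<sigma> * (4 * \<kappa>)" by (rule mult_le_mono2)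
      then have "76 * \<sigma> \<le> 36 * q'" using quad by (simp add: distrib_left)
      then show False using neg \<kappa> \<kappa>_le r1 by linarith
    qed
    \<comment> \<open>failure would leave \<open>4 \<rho> \<le> r\<close>, and then \<open>3 (2 q + t) \<ge> \<kappa> - \<rho>\<close>
      suffices\<close>
    have mixed': "\<kappa> + 2 * \<rho> \<le> 2 * q + t + 3 * r + 4 + 8 * D"
    proof (rule ccontr)
      assume neg: "\<not> ?thesis"
      then have "2 * q + t + 3 * r + 3 + (8 * D + 1) \<le> \<kappa> + 2 * \<rho>" by simp
      then have "\<rho> * (2 * q + t + 3 * r + 3 + (8 * D + 1)) \<le> \<rho> * (\<kappa> + 2 * \<rho>)" by (rule mult_le_mono2)
      then have "\<rho> * (8 * D + 1) \<le> D * (q + t)" using mixed by (simp add: distrib_left)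
      also have "\<dots> \<le> D * (2 * r)" using \<kappa>' \<kappa>_le r1 by (intro mult_le_mono2) linarith
      finally have 1: "\<rho> * (8 * D + 1) \<le> D * (2 * r)" .
      have "4 * \<rho> \<le> r"
      proof (rule ccontr)
        assume "\<not> 4 * \<rho> \<le> r"
        then have "D * (2 * r) \<le> D * (8 * \<rho>)" by (intro mult_le_mono2) simp
        then have "\<rho> * (8 * D + 1) \<le> D * (8 * \<rho>)" using 1 by (rule le_trans[rotated])
        then show False using \<open>\<not> 4 * \<rho> \<le> r\<close> by (simp add: algebra_simps)
      qed
      then show False using neg \<kappa>' \<kappa>_le r1 by linarith
    qed
    have c1: "2 * real r \<le> 2 * real f + 2 * real q + 2 * real t + real \<rho> + 1" using cov by linarith
    have c2: "2 * real r \<le> 2 * real f + 2 * real q' + 2 * real t' + real \<rho>' + 1" using cov' by linarith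
    have reals: "real m = 5 * real f + real \<kappa>" "real \<kappa> = 4 * real q' + real \<sigma>"
      "real \<sigma> = 3 * real t' + real \<rho>'" "real \<kappa> = 4 * real q + 3 * real t + real \<rho>"
      "real t' + real \<rho>' \<le> real r + 2" "4 * real \<kappa> \<le> 5 * real q' + 10 * real r + 80"
      "real \<kappa> + 2 * real \<rho> \<le> 2 * real q + real t + 3 * real r + 4 + 8 * real D"
      "5 * real q' + 2 * real t' \<le> 5 * real q + 2 * real t"
      using m \<kappa> \<sigma> \<kappa>' triple quad' mixed' exch by linarith+
    have "55 * real r \<le> 18 * real m + (2000 + 2000 * real D)" using c1 c2 reals by linarith
    then show "55 * real r \<le> 18 * real (card E) + (2000 + 2000 * real D)" by (simp add: m_def)
  qed
qed

lemma admissible_cover_critical: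
  assumes r: "r \<ge> 1" and adm: "admissible r V E"
  shows "cover_critical_family E r"
proof
  have fV: "finite V" and EV: "E \<subseteq> Pow V" and un: "\<And>e. e \<in> E \<Longrightarrow> card e = r"
    and int: "intersecting E" and cn: "cover_number V E = r"
    using adm by (auto simp: admissible_def hypergraph_def uniform_def)
  show "finite E" using fV EV by (meson finite_Pow_iff finite_subset)
  show "r \<ge> 1" by (rule r)
  show "card e = r" if "e \<in> E" for e using un that .
  show "e \<inter> f \<noteq> {}" if "e \<in> E" "f \<in> E" for e f
  proof (cases "e = f")
    case True
    then show ?thesis using un[OF that(1)] r by auto
  next
    case False
    then show ?thesis using int that by (simp add: intersecting_def pairwise_def)
  qed
  show "r \<le> card T" if T: "finite T" "\<And>e. e \<in> E \<Longrightarrow> T \<inter> e \<noteq> {}" for T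
  proof -
    have "cover V E (T \<inter> V)" unfolding cover_def using T(2) EV by blast
    then have "cover_number V E \<le> card (T \<inter> V)"
      unfolding cover_number_def by (intro Least_le) blast
    also have "\<dots> \<le> card T" using T(1) by (intro card_mono) auto
    finally show ?thesis using cn by simp
  qed
qed

theorem theorem1:
  "(\<forall>r::nat. r \<ge> 1 \<longrightarrow> int (min_edges r) \<ge> 3 * int r - 4) \<and>
   (\<forall>\<epsilon>::real. \<epsilon> > 0 \<longrightarrow>
      (\<exists>r0::nat. \<forall>r\<ge>r0. real (min_edges r) \<ge> ((41 - sqrt 19) / 12 - \<epsilon>) * real r))"
proof (intro conjI allI impI)
  fix r :: nat assume "r \<ge> 1"
  then obtain V :: "nat set" and E where E: "admissible r V E" "card E = min_edges r"
    using min_edges_attained by blast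
  interpret cover_critical_family E r by (rule admissible_cover_critical[OF \<open>r \<ge> 1\<close> E(1)])
  show "int (min_edges r) \<ge> 3 * int r - 4" using edges_ge_3r_minus_4 E(2) by linarith
next
  fix \<epsilon> :: real assume \<epsilon>: "\<epsilon> > 0"
  obtain C where C: "\<And>(E :: nat set set) r. cover_critical_family E r \<Longrightarrow>
      55 * real r \<le> 18 * real (card E) + C"
    using edge_count_ge_55_18 by blast
  have "13 / 3 < sqrt 19" by (rule real_less_rsqrt) (simp add: power2_eq_square)
  then have const: "(41 - sqrt 19) / 12 - \<epsilon> \<le> 55 / 18 - \<epsilon>" by (simp add: field_simps)
  define r0 where "r0 = max 1 (nat \<lceil>C / (18 * \<epsilon>)\<rceil>)"
  show "\<exists>r0::nat. \<forall>r\<ge>r0. real (min_edges r) \<ge> ((41 - sqrt 19) / 12 - \<epsilon>) * real r"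
  proof (intro exI[of _ r0] allI impI)
    fix r assume r: "r \<ge> r0"
    then have r1: "r \<ge> 1" by (simp add: r0_def)
    obtain V :: "nat set" and E where E: "admissible r V E" "card E = min_edges r"
      using min_edges_attained[OF r1] by blast
    have "C / (18 * \<epsilon>) \<le> real r" using r by (simp add: r0_def nat_ceiling_le_eq)
    then have "C \<le> 18 * \<epsilon> * real r" using \<epsilon> by (simp add: field_simps)
    moreover have "55 * real r \<le> 18 * real (min_edges r) + C"
      using C[OF admissible_cover_critical[OF r1 E(1)]] E(2) by simp
    ultimately have "(55 / 18 - \<epsilon>) * real r \<le> real (min_edges r)" by (simp add: field_simps)
    moreover have "((41 - sqrt 19) / 12 - \<epsilon>) * real r \<le> (55 / 18 - \<epsilon>) * real r"
      using const by (intro mult_right_mono) auto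
    ultimately show "real (min_edges r) \<ge> ((41 - sqrt 19) / 12 - \<epsilon>) * real r" by linarith
  qed
qed

end
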